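(* Let $X_1,X_2,\dots$ be i.i.d. with law $P$, a probability distribution on $[0,1]$ with mean $m$ and variance $\sigma^2>0$. Let $C\in(0,1)$ and let the aGRAPA bet fraction be $$\lambda_n^{\mathsf{aGRAPA}}=\Bigl(-\frac{C}{1-m}\Bigr)\vee\frac{\widehat\mu_{n-1}-m}{\widehat\sigma_{n-1}^2+(\widehat\mu_{n-1}-m)^2}\wedge\frac Cm,$$ where $\widehat\mu_{n-1}$ and $\widehat\sigma^2_{n-1}$ are the sample mean and sample variance of $X_1,\dots,X_{n-1}$. Then $$\sqrt n\,\lambda_n^{\mathsf{aGRAPA}}\longrightarrow\mathcal N(0,\sigma^{-2})\quad\text{weakly}.$$ Therefore $\lambda_n^{\mathsf{aGRAPA}}=\Omega_p(n^{-1/2})$, and the aGRAPA wealth process $\prod_{k=1}^n\bigl(1+\lambda_k^{\mathsf{aGRAPA}}(X_k-m)\bigr)$ converges to $0$ almost surely as $n\to\infty$.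
   Context: The expression $a\vee b\wedge c$ with $a<c$ denotes $b$ clipped to the interval $[a,c]$. The sample variance may use either usual normalization (dividing by the number of observations, or by that number minus one). When the ratio is undefined (no or too few observations, or a zero denominator), $\lambda_n^{\mathsf{aGRAPA}}$ is given any $\sigma(X_1,\dots,X_{n-1})$-measurable value in $[-\frac C{1-m},\frac Cm]$. For random variables $(Y_n)$ and positive nonrandom $(a_n)$, $Y_n=\Omega_p(a_n)$ means that for every $\varepsilon>0$ there is $\delta>0$ with $\mathbb P(|Y_n|\ge\delta a_n)\ge1-\varepsilon$ for all but finitely many $n$. *)

theory Defs
  imports "HOL-Probability.Probability"
begin

definition sample_mean :: "(nat \<Rightarrow> real) \<Rightarrow> nat \<Rightarrow> real" where
  "sample_mean x k = (\<Sum>i=1..k. x i) / real k"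

(* d = 0 and d = 1 are the two usual normalizations, by k and by k - 1. *)
definition sample_var :: "nat \<Rightarrow> (nat \<Rightarrow> real) \<Rightarrow> nat \<Rightarrow> real" where
  "sample_var d x k = (\<Sum>i=1..k. (x i - sample_mean x k)\<^sup>2) / (real k - real d)"

definition clip :: "real \<Rightarrow> real \<Rightarrow> real \<Rightarrow> real" where
  "clip a b c = max a (min b c)"

definition aGRAPA_denom :: "nat \<Rightarrow> real \<Rightarrow> (nat \<Rightarrow> real) \<Rightarrow> nat \<Rightarrow> real" where
  "aGRAPA_denom d m x k = sample_var d x k + (sample_mean x k - m)\<^sup>2"

(* The condition d < k says that the sample mean and the sample variance both exist:
   k > 0 observations if d = 0, and k > 1 observations if d = 1. *)
definition aGRAPA_defined :: "nat \<Rightarrow> real \<Rightarrow> (nat \<Rightarrow> real) \<Rightarrow> nat \<Rightarrow> bool" where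
  "aGRAPA_defined d m x k \<longleftrightarrow> d < k \<and> aGRAPA_denom d m x k \<noteq> 0"

(* The bet of round n \<ge> 1; U n is the value taken where the ratio is undefined. *)
definition aGRAPA_bet ::
  "nat \<Rightarrow> real \<Rightarrow> real \<Rightarrow> (nat \<Rightarrow> 'a \<Rightarrow> real) \<Rightarrow> (nat \<Rightarrow> 'a \<Rightarrow> real) \<Rightarrow> nat \<Rightarrow> 'a \<Rightarrow> real" where
  "aGRAPA_bet d C m U X n \<omega> =
     (let x = (\<lambda>i. X i \<omega>); k = n - 1 in
      if aGRAPA_defined d m x k
      then clip (- (C / (1 - m))) ((sample_mean x k - m) / aGRAPA_denom d m x k) (C / m)
      else U n \<omega>)"

definition wealth :: "real \<Rightarrow> (nat \<Rightarrow> 'a \<Rightarrow> real) \<Rightarrow> (nat \<Rightarrow> 'a \<Rightarrow> real) \<Rightarrow> nat \<Rightarrow> 'a \<Rightarrow> real" where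
  "wealth m lam X n \<omega> = (\<Prod>k=1..n. 1 + lam k \<omega> * (X k \<omega> - m))"

(* The sigma-algebra generated by X 1, ..., X (n - 1); trivial for n = 1. *)
definition past :: "'a measure \<Rightarrow> (nat \<Rightarrow> 'a \<Rightarrow> real) \<Rightarrow> nat \<Rightarrow> 'a measure" where
  "past M X n = sigma (space M) {X i -` A \<inter> space M | i A. i \<in> {1..<n} \<and> A \<in> sets borel}"

definition Omega_p :: "'a measure \<Rightarrow> (nat \<Rightarrow> 'a \<Rightarrow> real) \<Rightarrow> (nat \<Rightarrow> real) \<Rightarrow> bool" where
  "Omega_p M Y a \<longleftrightarrow>
     (\<forall>\<epsilon>>0. \<exists>\<delta>>0. \<forall>\<^sub>F n in sequentially.
        measure M {\<omega> \<in> space M. \<bar>Y n \<omega>\<bar> \<ge> \<delta> * a n} \<ge> 1 - \<epsilon>)"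

end

(* Write k = n - 1, e for the centred sample mean, q for the empirical second moment about m, and
   s = sigma^2. The denominator of the bet is (k q - d e^2) / (k - d). By Hoeffding's inequality both
   |e| and |q - s| are below eta = k^(-1/3) with probability tending to 1; there the clipping is
   inactive and sqrt n * bet differs from sqrt k * e / s by O(sqrt k * eta^2) = o(1). The CLT and
   Slutsky's lemma give weak convergence, and since the limit has no atoms, the bet is
   Omega_p(n^(-1/2)).

   Omega_p(n^(-1/2)) forces sum lam_n^2 = infinity almost surely: on an event of positive probability
   where the sum is bounded by K, the expectations of lam_n^2 would be at least const / n. Finally
   sqrt(1 + y) <= 1 + y/2 - c y^2 for y = lam_n (X_n - m), and the right-hand side has conditional
   mean 1 - c s lam_n^2. So the square root of the wealth is at most a nonnegative martingale, bounded
   almost surely by Ville's inequality, times exp(- c s sum lam_k^2), which tends to 0. *)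
theory Submission
  imports Defs "HOL-Real_Asymp.Real_Asymp"
begin

section \<open>Convergence in distribution and in probability\<close>

lemma (in prob_space) integrable_indicator_event:
  "A \<in> events \<Longrightarrow> integrable M (indicator A :: 'a \<Rightarrow> real)"
  by (rule integrable_real_indicator) (auto simp: emeasure_eq_measure)

text \<open>Slutsky's lemma via Levy continuity. As u -> exp(iu) is 1-Lipschitz with values of
  modulus 1, the characteristic functions at \<open>t\<close> differ by at most |t|
  \<open>\<epsilon>\<close> plus twice the probability that \<open>Y n\<close> and
  \<open>Z n\<close> are more than \<open>\<epsilon>\<close> apart.\<close>

lemma (in prob_space) weak_conv_m_of_close:
  fixes Y Z :: "nat \<Rightarrow> 'a \<Rightarrow> real"
  assumes [measurable]: "\<And>n. Y n \<in> borel_measurable M" "\<And>n. Z n \<in> borel_measurable M"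
    and mu: "real_distribution \<mu>"
    and conv: "weak_conv_m (\<lambda>n. distr M borel (Z n)) \<mu>"
    and close: "\<And>\<epsilon>. \<epsilon> > 0 \<Longrightarrow> (\<lambda>n. prob {x \<in> space M. \<epsilon> < \<bar>Y n x - Z n x\<bar>}) \<longlonglongrightarrow> 0"
  shows "weak_conv_m (\<lambda>n. distr M borel (Y n)) \<mu>"
proof (rule levy_continuity[OF _ mu])
  show "real_distribution (distr M borel (Y n))" for n
    by (rule real_distribution_distr) simp
  fix t :: real
  have char_Z: "(\<lambda>n. char (distr M borel (Z n)) t) \<longlonglongrightarrow> char \<mu> t"
    by (rule levy_continuity1[OF _ mu conv]) (simp add: real_distribution_distr)
  have bound: "cmod (char (distr M borel (Y n)) t - char (distr M borel (Z n)) t)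
      \<le> \<bar>t\<bar> * \<epsilon> + 2 * prob {x \<in> space M. \<epsilon> < \<bar>Y n x - Z n x\<bar>}" if "\<epsilon> > 0" for n \<epsilon>
  proof -
    let ?B = "{x \<in> space M. \<epsilon> < \<bar>Y n x - Z n x\<bar>}"
    have int: "integrable M (\<lambda>x. iexp (t * Y n x))" "integrable M (\<lambda>x. iexp (t * Z n x))"
      by (auto intro!: integrable_const_bound[where B=1])
    have ind: "integrable M (indicator ?B :: _ \<Rightarrow> real)"
      by (rule integrable_indicator_event) simp
    have pt: "cmod (iexp (t * Y n x) - iexp (t * Z n x)) \<le> \<bar>t\<bar> * \<epsilon> + 2 * indicator ?B x"
      if x: "x \<in> space M" for x
    proof (cases "x \<in> ?B")
      case True
      have "cmod (iexp (t * Y n x) - iexp (t * Z n x)) \<le> 1 + 1"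
        by (rule norm_triangle_le_diff) simp
      moreover have "0 \<le> \<bar>t\<bar> * \<epsilon>" using \<open>\<epsilon> > 0\<close> by simp
      ultimately show ?thesis using True by simp
    next
      case False
      \<comment> \<open>Factoring out a number of modulus 1 leaves \<open>iexp u - 1\<close>, whose
        modulus is at most |u|.\<close>
      have "iexp (t * Y n x) - iexp (t * Z n x)
          = iexp (t * Z n x) * (iexp (t * (Y n x - Z n x)) - 1)"
        by (simp add: algebra_simps flip: exp_add)
      then have "cmod (iexp (t * Y n x) - iexp (t * Z n x))
          = cmod (iexp (t * (Y n x - Z n x)) - 1)"
        by (simp add: norm_mult)
      also have "\<dots> \<le> \<bar>t * (Y n x - Z n x)\<bar>"
        using iexp_approx1[of "t * (Y n x - Z n x)" 0] by simp
      also have "\<dots> \<le> \<bar>t\<bar> * \<epsilon>"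
        using False x by (auto simp: abs_mult intro!: mult_left_mono)
      finally show ?thesis using False by simp
    qed
    have "cmod (char (distr M borel (Y n)) t - char (distr M borel (Z n)) t)
        = cmod (\<integral>x. iexp (t * Y n x) - iexp (t * Z n x) \<partial>M)"
      using int by (simp add: char_def integral_distr)
    also have "\<dots> \<le> (\<integral>x. cmod (iexp (t * Y n x) - iexp (t * Z n x)) \<partial>M)"
      by (rule integral_norm_bound)
    also have "\<dots> \<le> (\<integral>x. \<bar>t\<bar> * \<epsilon> + 2 * indicator ?B x \<partial>M)"
      using int pt ind by (intro integral_mono) auto
    also have "\<dots> = \<bar>t\<bar> * \<epsilon> + 2 * prob ?B"
      using ind by (subst Bochner_Integration.integral_add) (auto simp: prob_space)
    finally show ?thesis .
  qed
  have "(\<lambda>n. char (distr M borel (Y n)) t - char (distr M borel (Z n)) t) \<longlonglongrightarrow> 0"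
  proof (rule LIMSEQ_I)
    fix r :: real assume "r > 0"
    \<comment> \<open>The \<open>+ 1\<close> covers \<open>t = 0\<close>. Each of the two terms in
      \<open>bound\<close> is to stay below \<open>r / 2\<close>, hence the threshold
      \<open>r / 4\<close> for the probability.\<close>
    define \<epsilon> where "\<epsilon> = r / (2 * (\<bar>t\<bar> + 1))"
    have \<epsilon>: "\<epsilon> > 0" "\<bar>t\<bar> * \<epsilon> < r / 2"
      using \<open>r > 0\<close> by (auto simp: \<epsilon>_def field_simps add_pos_nonneg)
    have "\<forall>\<^sub>F n in sequentially. prob {x \<in> space M. \<epsilon> < \<bar>Y n x - Z n x\<bar>} < r / 4"
      using order_tendstoD(2)[OF close[OF \<epsilon>(1)], of "r / 4"] \<open>r > 0\<close> by simp
    then obtain N where "\<And>n. n \<ge> N \<Longrightarrow> prob {x \<in> space M. \<epsilon> < \<bar>Y n x - Z n x\<bar>} < r / 4"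
      unfolding eventually_sequentially by blast
    then have "cmod (char (distr M borel (Y n)) t - char (distr M borel (Z n)) t) < r" if "n \<ge> N" for n
      using that bound[OF \<epsilon>(1), of n] \<epsilon>(2) by fastforce
    then show "\<exists>N. \<forall>n\<ge>N. cmod (char (distr M borel (Y n)) t - char (distr M borel (Z n)) t - 0) < r"
      by auto
  qed
  from tendsto_add[OF this char_Z]
  show "(\<lambda>n. char (distr M borel (Y n)) t) \<longlonglongrightarrow> char \<mu> t" by simp
qed

text \<open>The events agree eventually for each fixed \<open>\<delta>\<close>, so the same
  \<open>\<delta>\<close> serves both sequences. This covers both a deterministic rescaling and a
  change of finitely many terms.\<close>

lemma Omega_p_transfer:
  assumes "Omega_p M Z b"
    and eq: "\<And>\<delta>. \<forall>\<^sub>F n in sequentially. \<forall>\<omega>\<in>space M. \<delta> * a n \<le> \<bar>Y n \<omega>\<bar> \<longleftrightarrow> \<delta> * b n \<le> \<bar>Z n \<omega>\<bar>"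
  shows "Omega_p M Y a"
  unfolding Omega_p_def
proof (intro allI impI)
  fix \<epsilon> :: real assume "\<epsilon> > 0"
  then obtain \<delta> where \<delta>: "\<delta> > 0"
    "\<forall>\<^sub>F n in sequentially. 1 - \<epsilon> \<le> measure M {\<omega> \<in> space M. \<delta> * b n \<le> \<bar>Z n \<omega>\<bar>}"
    using assms(1) unfolding Omega_p_def by blast
  from \<delta>(2) eq[of \<delta>]
  have "\<forall>\<^sub>F n in sequentially. 1 - \<epsilon> \<le> measure M {\<omega> \<in> space M. \<delta> * a n \<le> \<bar>Y n \<omega>\<bar>}"
    by eventually_elim (simp cong: conj_cong)
  with \<delta>(1) show "\<exists>\<delta>>0. \<forall>\<^sub>F n in sequentially.
      1 - \<epsilon> \<le> measure M {\<omega> \<in> space M. \<delta> * a n \<le> \<bar>Y n \<omega>\<bar>}"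
    by blast
qed

text \<open>A limit without an atom at 0 gives little mass to a small interval around 0. Its cdf is
  continuous at both endpoints, so the laws of \<open>Y n\<close> eventually give that interval
  little mass too.\<close>

lemma (in prob_space) Omega_p_of_weak_conv:
  assumes [measurable]: "\<And>n. Y n \<in> borel_measurable M"
    and mu: "real_distribution \<mu>" and atomless: "\<And>x. measure \<mu> {x} = 0"
    and conv: "weak_conv_m (\<lambda>n. distr M borel (Y n)) \<mu>"
  shows "Omega_p M Y (\<lambda>_. 1)"
  unfolding Omega_p_def
proof (intro allI impI)
  fix \<epsilon> :: real assume "\<epsilon> > 0"
  interpret mu: real_distribution \<mu> by fact
  have cont: "isCont (cdf \<mu>) x" for x by (simp add: mu.isCont_cdf atomless)
  obtain s where s: "s > 0" "\<And>x. \<bar>x\<bar> < s \<Longrightarrow> \<bar>cdf \<mu> x - cdf \<mu> 0\<bar> < \<epsilon> / 2"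
    using cont[of 0] \<open>\<epsilon> > 0\<close> unfolding continuous_at_eps_delta dist_real_def
    by (metis diff_zero half_gt_zero)
  \<comment> \<open>Halving puts \<open>\<delta>\<close> and \<open>- \<delta>\<close> strictly
    inside the range of continuity; the two errors \<open>\<epsilon> / 2\<close> then add up to
    \<open>\<epsilon>\<close>.\<close>
  define \<delta> where "\<delta> = s / 2"
  have \<delta>: "\<delta> > 0" "cdf \<mu> \<delta> - cdf \<mu> (- \<delta>) < \<epsilon>"
    using s(2)[of \<delta>] s(2)[of "-\<delta>"] s(1) unfolding \<delta>_def by (simp_all, linarith)
  have "(\<lambda>n. cdf (distr M borel (Y n)) \<delta> - cdf (distr M borel (Y n)) (- \<delta>))
      \<longlonglongrightarrow> cdf \<mu> \<delta> - cdf \<mu> (- \<delta>)"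
    using conv cont by (auto simp: weak_conv_m_def weak_conv_def intro!: tendsto_diff)
  from order_tendstoD(2)[OF this \<delta>(2)]
  have "\<forall>\<^sub>F n in sequentially. 1 - \<epsilon> \<le> prob {\<omega> \<in> space M. \<delta> * 1 \<le> \<bar>Y n \<omega>\<bar>}"
  proof eventually_elim
    case (elim n)
    interpret D: real_distribution "distr M borel (Y n)" by (rule real_distribution_distr) simp
    have "cdf (distr M borel (Y n)) \<delta> - cdf (distr M borel (Y n)) (- \<delta>)
        = measure (distr M borel (Y n)) {-\<delta><..\<delta>}"
      using \<delta>(1) by (intro D.cdf_diff_eq) auto
    also have "\<dots> = prob (Y n -` {-\<delta><..\<delta>} \<inter> space M)"
      by (rule measure_distr) auto
    finally have "prob (Y n -` {-\<delta><..\<delta>} \<inter> space M) < \<epsilon>" using elim by simp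
    moreover have "1 - prob (Y n -` {-\<delta><..\<delta>} \<inter> space M)
        = prob (space M - (Y n -` {-\<delta><..\<delta>} \<inter> space M))"
      by (subst prob_compl) auto
    \<comment> \<open>The cdf difference measures a half-open interval; outside it the absolute
      value is still at least \<open>\<delta>\<close>.\<close>
    moreover have "\<dots> \<le> prob {\<omega> \<in> space M. \<delta> * 1 \<le> \<bar>Y n \<omega>\<bar>}"
      by (rule finite_measure_mono) auto
    ultimately show ?case by linarith
  qed
  with \<delta>(1) show "\<exists>\<delta>>0. \<forall>\<^sub>F n in sequentially. 1 - \<epsilon> \<le> prob {\<omega> \<in> space M. \<delta> * 1 \<le> \<bar>Y n \<omega>\<bar>}"
    by blast
qed

text \<open>If the sum of squares stayed below \<open>K\<close> on an event of positive probability,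
  the expectations of the squares restricted to that event would have a finite sum, yet they
  dominate a multiple of the harmonic series.\<close>

lemma (in prob_space) AE_not_summable_of_Omega_p:
  assumes [measurable]: "\<And>n. lam n \<in> borel_measurable M"
    and om: "Omega_p M lam (\<lambda>n. real n powr (- 1 / 2))"
  shows "AE \<omega> in M. \<not> summable (\<lambda>n. (lam n \<omega>)\<^sup>2)"
proof -
  define E where "E K = {\<omega> \<in> space M. \<forall>N. (\<Sum>n<N. (lam n \<omega>)\<^sup>2) \<le> real K}" for K
  have [measurable]: "E K \<in> events" for K unfolding E_def by measurable
  have "prob (E K) = 0" for K
  proof (rule ccontr)
    assume "prob (E K) \<noteq> 0"
    define p where "p = prob (E K)"
    have p: "p > 0" unfolding p_def using \<open>prob (E K) \<noteq> 0\<close> by (simp add: zero_less_measure_iff)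
    \<comment> \<open>The level \<open>p / 2\<close> leaves the large-bet event an overlap of
      probability at least \<open>p / 2\<close> with \<open>E K\<close>.\<close>
    obtain \<delta> where \<delta>: "\<delta> > 0" "\<forall>\<^sub>F n in sequentially.
        1 - p / 2 \<le> prob {\<omega> \<in> space M. \<delta> * real n powr (- 1 / 2) \<le> \<bar>lam n \<omega>\<bar>}"
      using om p unfolding Omega_p_def by (meson half_gt_zero)
    define f where "f n = (\<integral>\<omega>. (lam n \<omega>)\<^sup>2 * indicator (E K) \<omega> \<partial>M)" for n
    have le_K: "(lam n \<omega>)\<^sup>2 \<le> K" if "\<omega> \<in> E K" for n \<omega>
    proof -
      have "(lam n \<omega>)\<^sup>2 \<le> (\<Sum>i<Suc n. (lam i \<omega>)\<^sup>2)" by (simp add: sum_nonneg)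
      also have "\<dots> \<le> K" using that unfolding E_def by blast
      finally show ?thesis .
    qed
    have int: "integrable M (\<lambda>\<omega>. (lam n \<omega>)\<^sup>2 * indicator (E K) \<omega>)" for n
      by (rule integrable_const_bound[where B="real K"]) (auto simp: indicator_def le_K)
    have "sum f {..<N} \<le> K" for N
    proof -
      have "sum f {..<N} = (\<integral>\<omega>. (\<Sum>n<N. (lam n \<omega>)\<^sup>2 * indicator (E K) \<omega>) \<partial>M)"
        unfolding f_def by (rule Bochner_Integration.integral_sum[symmetric]) (rule int)
      also have "\<dots> \<le> (\<integral>\<omega>. real K \<partial>M)"
      proof (rule integral_mono)
        show "(\<Sum>n<N. (lam n \<omega>)\<^sup>2 * indicator (E K) \<omega>) \<le> real K" for \<omega>
          by (cases "\<omega> \<in> E K") (auto simp: E_def)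
      qed (intro Bochner_Integration.integrable_sum int, simp)
      finally show ?thesis by (simp add: prob_space)
    qed
    then have "summable f"
      by (intro summableI_nonneg_bounded) (auto simp: f_def)
    \<comment> \<open>On the overlap of \<open>E K\<close> with the large-bet event, the squared bet
      is at least \<open>\<delta>\<^sup>2 / n\<close>.\<close>
    moreover have "\<forall>\<^sub>F n in sequentially. norm (\<delta>\<^sup>2 * (p / 2) * inverse (real n)) \<le> f n"
      using \<delta>(2) eventually_gt_at_top[of 0]
    proof eventually_elim
      case (elim n)
      let ?A = "{\<omega> \<in> space M. \<delta> * real n powr (- 1 / 2) \<le> \<bar>lam n \<omega>\<bar>}"
      have "prob (E K \<union> ?A) = prob (E K) + prob ?A - prob (E K \<inter> ?A)"
        by (simp add: measure_Un3 fmeasurable_eq_sets)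
      then have "p / 2 \<le> prob (E K \<inter> ?A)"
        using elim prob_le_1[of "E K \<union> ?A"] unfolding p_def by linarith
      moreover have sq: "(\<delta> * real n powr (- 1 / 2))\<^sup>2 = \<delta>\<^sup>2 * inverse (real n)"
        using elim by (simp add: power_mult_distrib powr_minus powr_half_sqrt power_inverse)
      ultimately have "\<delta>\<^sup>2 * (p / 2) * inverse (real n)
          \<le> (\<delta> * real n powr (- 1 / 2))\<^sup>2 * prob (E K \<inter> ?A)"
        using mult_left_mono[of "p / 2" "prob (E K \<inter> ?A)" "\<delta>\<^sup>2 * inverse (real n)"]
        by (simp only: sq) (simp add: mult_ac)
      also have "\<dots> = (\<integral>\<omega>. (\<delta> * real n powr (- 1 / 2))\<^sup>2 * indicator (E K \<inter> ?A) \<omega> \<partial>M)"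
        by simp
      also have "\<dots> \<le> f n"
        unfolding f_def
      proof (rule integral_mono)
        show "(\<delta> * real n powr (- 1 / 2))\<^sup>2 * indicator (E K \<inter> ?A) \<omega>
            \<le> (lam n \<omega>)\<^sup>2 * indicator (E K) \<omega>" for \<omega>
          using \<delta>(1) by (auto simp: indicator_def simp flip: abs_le_square_iff)
      qed (use int in \<open>auto intro!: integrable_mult_right integrable_indicator_event\<close>)
      finally show ?case using p elim by simp
    qed
    ultimately have "summable (\<lambda>n. \<delta>\<^sup>2 * (p / 2) * inverse (real n))"
      by (rule summable_comparison_test_ev[rotated])
    then have "summable (\<lambda>n. inverse (real n))"
      using \<delta>(1) p by (subst (asm) summable_cmult_iff) auto
    then show False using not_summable_harmonic[where 'a=real] by simp
  qed
  then have "AE \<omega> in M. \<forall>K. \<omega> \<notin> E K"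
    by (subst AE_all_countable) (auto intro!: AE_not_in simp: null_sets_def emeasure_eq_measure)
  then show ?thesis
    using AE_space
  proof eventually_elim
    case (elim \<omega>)
    show ?case
    proof
      assume s: "summable (\<lambda>n. (lam n \<omega>)\<^sup>2)"
      obtain K where K: "(\<Sum>n. (lam n \<omega>)\<^sup>2) \<le> real K" using real_arch_simple by blast
      have "(\<Sum>n<N. (lam n \<omega>)\<^sup>2) \<le> real K" for N
        using sum_le_suminf[OF s, of "{..<N}"] K by simp
      then show False using elim by (auto simp: E_def)
    qed
  qed
qed

section \<open>Reindexing and rescaling for the central limit theorem\<close>

lemma (in prob_space) indep_sets_reindex:
  assumes inj: "inj_on f I" and indep: "indep_sets F (f ` I)"
  shows "indep_sets (\<lambda>i. F (f i)) I"
proof (rule indep_setsI)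
  show "F (f i) \<subseteq> events" if "i \<in> I" for i
    using indep that by (auto simp: indep_sets_def)
  fix A J assume J: "J \<noteq> {}" "J \<subseteq> I" "finite J" "\<forall>j\<in>J. A j \<in> F (f j)"
  define A' where "A' = (\<lambda>i. A (the_inv_into I f i))"
  have A': "A' (f j) = A j" if "j \<in> J" for j
    using that J(2) inj by (auto simp: A'_def the_inv_into_f_f)
  have "inj_on f J" using inj J(2) by (rule inj_on_subset)
  have "prob (\<Inter>j\<in>f ` J. A' j) = (\<Prod>j\<in>f ` J. prob (A' j))"
    using J by (intro indep_setsD[OF indep]) (auto simp: A')
  then show "prob (\<Inter>j\<in>J. A j) = (\<Prod>j\<in>J. prob (A j))"
    using A' by (simp add: prod.reindex[OF \<open>inj_on f J\<close>] cong: INF_cong_simp)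
qed

lemma (in prob_space) indep_vars_reindex:
  assumes "inj_on f I" "indep_vars N X (f ` I)"
  shows "indep_vars (\<lambda>i. N (f i)) (\<lambda>i. X (f i)) I"
  using assms(2) indep_sets_reindex[OF assms(1), of "\<lambda>i. {X i -` A \<inter> space M |A. A \<in> sets (N i)}"]
  by (simp add: indep_vars_def2)

text \<open>The normal law with standard deviation \<open>c\<close> is the image of the standard one
  under multiplication by \<open>c\<close>, and the characteristic function of
  \<open>c * Z n\<close> at \<open>t\<close> is that of \<open>Z n\<close> at
  \<open>t * c\<close>.\<close>

lemma weak_conv_m_scale_std_normal:
  assumes M: "prob_space M" and c: "c > 0" and [measurable]: "\<And>n. Z n \<in> borel_measurable M"
    and conv: "weak_conv_m (\<lambda>n. distr M borel (Z n)) std_normal_distribution"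
  shows "weak_conv_m (\<lambda>n. distr M borel (\<lambda>\<omega>. c * Z n \<omega>)) (density lborel (normal_density 0 c))"
proof -
  interpret prob_space M by fact
  interpret N: real_distribution std_normal_distribution by (rule real_dist_normal_dist)
  have "distributed std_normal_distribution lborel (\<lambda>x. x) std_normal_density"
    by (auto simp: distributed_def normal_density_nonneg intro!: measure_eqI simp: emeasure_distr)
  then have "distributed std_normal_distribution lborel (\<lambda>x. 0 + c * x) (normal_density (0 + c * 0) (\<bar>c\<bar> * 1))"
    using c by (intro N.normal_density_affine) auto
  then have "density lborel (normal_density 0 c) = distr std_normal_distribution lborel (\<lambda>x. c * x)"
    using c distributed_distr_eq_density by fastforce
  also have "\<dots> = distr std_normal_distribution borel (\<lambda>x. c * x)"
    by (rule distr_cong) auto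
  finally have eq: "density lborel (normal_density 0 c) = distr std_normal_distribution borel (\<lambda>x. c * x)" .
  show ?thesis
    unfolding eq
  proof (rule levy_continuity)
    show "real_distribution (distr M borel (\<lambda>\<omega>. c * Z n \<omega>))" for n
      by (rule real_distribution_distr) simp
    show "real_distribution (distr std_normal_distribution borel (\<lambda>x. c * x))"
      by (rule N.real_distribution_distr) simp
    fix t
    have "(\<lambda>n. char (distr M borel (Z n)) (t * c)) \<longlonglongrightarrow> char std_normal_distribution (t * c)"
      by (rule levy_continuity1[OF _ real_dist_normal_dist conv]) (simp add: real_distribution_distr)
    then show "(\<lambda>n. char (distr M borel (\<lambda>\<omega>. c * Z n \<omega>)) t)
        \<longlonglongrightarrow> char (distr std_normal_distribution borel (\<lambda>x. c * x)) t"
      by (simp add: char_def integral_distr mult.assoc)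
  qed
qed

section \<open>Maximal inequality and elementary estimates\<close>

text \<open>Ville's inequality. The supermartingale property is stated through integrals over past
  events, which is all that the induction on time uses and avoids conditional expectations.\<close>

lemma (in prob_space) maximal_inequality:
  fixes V :: "nat \<Rightarrow> 'a \<Rightarrow> real"
  assumes sub: "\<And>n. subalgebra M (F n)" and mono: "\<And>n. sets (F n) \<subseteq> sets (F (Suc n))"
    and adapted: "\<And>n. V n \<in> borel_measurable (F n)"
    and int: "\<And>n. integrable M (V n)" and nonneg: "\<And>n. AE \<omega> in M. V n \<omega> \<ge> 0"
    and super: "\<And>n A. A \<in> sets (F n) \<Longrightarrow>
      (\<integral>\<omega>. V (Suc n) \<omega> * indicator A \<omega> \<partial>M) \<le> (\<integral>\<omega>. V n \<omega> * indicator A \<omega> \<partial>M)"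
  shows "a * prob {\<omega> \<in> space M. \<exists>k\<le>n. a \<le> V k \<omega>} \<le> expectation (V 0)"
proof -
  have sp: "space (F n) = space M" for n using sub by (simp add: subalgebra_def)
  have FM: "A \<in> sets (F n) \<Longrightarrow> A \<in> events" for A n using sub by (auto simp: subalgebra_def)
  define B where "B n = {\<omega> \<in> space M. \<exists>k\<le>n. a \<le> V k \<omega>}" for n
  have level: "{\<omega> \<in> space M. a \<le> V n \<omega>} \<in> sets (F n)" for n
    using measurable_sets[OF adapted, of "{a..}" n] by (simp add: sp vimage_def Int_def conj_commute)
  have B_Suc: "B (Suc n) = B n \<union> {\<omega> \<in> space M. a \<le> V (Suc n) \<omega>}" for n
    by (auto simp: B_def le_Suc_eq)
  have B: "B n \<in> sets (F n)" for n
  proof (induction n)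
    case 0
    show ?case using level[of 0] by (simp add: B_def)
  next
    case (Suc n)
    then show ?case using mono[of n] level[of "Suc n"] unfolding B_Suc by blast
  qed
  note [measurable] = FM[OF B] FM[OF level]
  have intI: "integrable M (\<lambda>\<omega>. V n \<omega> * indicator A \<omega>)" if "A \<in> events" for A n
    using integrable_real_mult_indicator[OF that int] .
  \<comment> \<open>Points of \<open>A'\<close> have reached level \<open>a\<close>, so their share
    of the integral can be traded for \<open>a * prob A'\<close>.\<close>
  have split: "(\<integral>\<omega>. V n \<omega> * indicator A \<omega> \<partial>M) + a * prob A' \<le> (\<integral>\<omega>. V n \<omega> * indicator (A \<union> A') \<omega> \<partial>M)"
    if A[measurable]: "A \<in> events" "A' \<in> events" and d: "A \<inter> A' = {}" "\<And>\<omega>. \<omega> \<in> A' \<Longrightarrow> a \<le> V n \<omega>" for n A A'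
  proof -
    have ind: "integrable M (\<lambda>\<omega>. a * indicator A' \<omega>)"
      by (intro integrable_mult_right integrable_indicator_event A)
    have "a * prob A' = (\<integral>\<omega>. a * indicator A' \<omega> \<partial>M)" by simp
    also have "\<dots> \<le> (\<integral>\<omega>. V n \<omega> * indicator A' \<omega> \<partial>M)"
      using ind by (intro integral_mono intI A) (auto simp: indicator_def d)
    also have "(\<integral>\<omega>. V n \<omega> * indicator A \<omega> \<partial>M) + \<dots> = (\<integral>\<omega>. V n \<omega> * indicator A \<omega> + V n \<omega> * indicator A' \<omega> \<partial>M)"
      using intI A by simp
    also have "\<dots> = (\<integral>\<omega>. V n \<omega> * indicator (A \<union> A') \<omega> \<partial>M)"
      using d(1) by (intro Bochner_Integration.integral_cong) (auto simp: indicator_def)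
    finally show ?thesis by simp
  qed
  \<comment> \<open>The induction invariant: the mass not yet stopped, plus \<open>a\<close> for
    each point that has already reached the level. It is a lower bound for the mean of the process
    stopped on reaching \<open>a\<close>.\<close>
  have "(\<integral>\<omega>. V n \<omega> * indicator (space M - B n) \<omega> \<partial>M) + a * prob (B n) \<le> expectation (V 0)"
  proof (induction n)
    case 0
    have "(\<integral>\<omega>. V 0 \<omega> * indicator (space M - B 0) \<omega> \<partial>M) + a * prob (B 0)
        \<le> (\<integral>\<omega>. V 0 \<omega> * indicator (space M - B 0 \<union> B 0) \<omega> \<partial>M)"
      by (rule split) (auto simp: B_def)
    also have "\<dots> = expectation (V 0)"
      by (rule Bochner_Integration.integral_cong) (auto simp: B_def)
    finally show ?case .
  next
    case (Suc n)
    let ?D = "B (Suc n) - B n"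
    have "(\<integral>\<omega>. V (Suc n) \<omega> * indicator (space M - B (Suc n)) \<omega> \<partial>M) + a * prob ?D
        \<le> (\<integral>\<omega>. V (Suc n) \<omega> * indicator ((space M - B (Suc n)) \<union> ?D) \<omega> \<partial>M)"
      by (rule split) (auto simp: B_Suc)
    also have "(space M - B (Suc n)) \<union> ?D = space M - B n"
      by (auto simp: B_def le_Suc_eq)
    \<comment> \<open>Not having reached \<open>a\<close> by time \<open>n\<close> is an event of
      \<open>F n\<close>, so the supermartingale inequality applies to it.\<close>
    also have "(\<integral>\<omega>. V (Suc n) \<omega> * indicator (space M - B n) \<omega> \<partial>M)
        \<le> (\<integral>\<omega>. V n \<omega> * indicator (space M - B n) \<omega> \<partial>M)"
      using B[of n] sets.compl_sets[of "B n" "F n"] by (intro super) (simp add: sp)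
    finally have "(\<integral>\<omega>. V (Suc n) \<omega> * indicator (space M - B (Suc n)) \<omega> \<partial>M) + a * prob ?D
        + a * prob (B n) \<le> expectation (V 0)"
      using Suc.IH by linarith
    moreover have "prob (B (Suc n)) = prob (B n) + prob ?D"
      by (subst finite_measure_Diff) (auto simp: B_Suc)
    ultimately show ?case by (simp add: algebra_simps)
  qed
  moreover have "0 \<le> (\<integral>\<omega>. V n \<omega> * indicator (space M - B n) \<omega> \<partial>M)"
    using nonneg[of n] by (intro integral_nonneg_AE) (auto elim: eventually_mono)
  ultimately show ?thesis unfolding B_def by linarith
qed

text \<open>By the maximal inequality, the probability of ever reaching level \<open>a\<close> is at
  most the initial mean divided by \<open>a\<close>. An unbounded path reaches every level, so such
  paths form a null set.\<close>

lemma (in prob_space) AE_bounded_of_supermartingale: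
  fixes V :: "nat \<Rightarrow> 'a \<Rightarrow> real"
  assumes sub: "\<And>n. subalgebra M (F n)" and mono: "\<And>n. sets (F n) \<subseteq> sets (F (Suc n))"
    and adapted: "\<And>n. V n \<in> borel_measurable (F n)"
    and int: "\<And>n. integrable M (V n)" and nonneg: "\<And>n. AE \<omega> in M. V n \<omega> \<ge> 0"
    and super: "\<And>n A. A \<in> sets (F n) \<Longrightarrow>
      (\<integral>\<omega>. V (Suc n) \<omega> * indicator A \<omega> \<partial>M) \<le> (\<integral>\<omega>. V n \<omega> * indicator A \<omega> \<partial>M)"
  shows "AE \<omega> in M. \<exists>K. \<forall>n. V n \<omega> \<le> K"
proof -
  have [measurable]: "V n \<in> borel_measurable M" for n using int by auto
  define B where "B a n = {\<omega> \<in> space M. \<exists>k\<le>n. real a \<le> V k \<omega>}" for a n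
  have [measurable]: "B a n \<in> events" for a n unfolding B_def by measurable
  define N where "N = (\<Inter>a. \<Union>n. B a n)"
  have [measurable]: "N \<in> events" unfolding N_def by measurable
  have "real a * prob N \<le> expectation (V 0)" for a
  proof -
    have "(\<lambda>n. prob (B a n)) \<longlonglongrightarrow> prob (\<Union>n. B a n)"
      by (rule finite_Lim_measure_incseq) (auto simp: incseq_def B_def intro: order_trans)
    then have "(\<lambda>n. real a * prob (B a n)) \<longlonglongrightarrow> real a * prob (\<Union>n. B a n)"
      by (rule tendsto_mult_left)
    then have "real a * prob (\<Union>n. B a n) \<le> expectation (V 0)"
      by (rule LIMSEQ_le_const2)
        (use maximal_inequality[of F V "real a", OF assms] in \<open>auto simp: B_def\<close>)
    moreover have "real a * prob N \<le> real a * prob (\<Union>n. B a n)"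
      unfolding N_def by (intro mult_left_mono finite_measure_mono) auto
    ultimately show ?thesis by linarith
  qed
  then have "prob N = 0"
    using reals_Archimedean3[of "prob N"] by (meson not_less measure_le_0_iff)
  then have "AE \<omega> in M. \<omega> \<notin> N"
    by (intro AE_not_in) (auto simp: null_sets_def emeasure_eq_measure)
  then show ?thesis
    using AE_space
  proof eventually_elim
    case (elim \<omega>)
    then obtain a where "\<And>n. \<omega> \<notin> B a n" by (auto simp: N_def)
    then have "V n \<omega> \<le> real a" for n using elim(2) by (auto simp: B_def not_le dest: less_imp_le)
    then show ?case by blast
  qed
qed

text \<open>With \<open>s = sqrt (1 + y)\<close> the gap \<open>1 + y / 2 - s\<close> equals \<open>(s - 1)\<^sup>2 / 2 = y\<^sup>2 / (2 * (s + 1)\<^sup>2)\<close>.\<close>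
lemma sqrt_one_plus_le:
  fixes y :: real
  assumes "y \<ge> -1" "y \<le> L" "L \<ge> 0"
  shows "sqrt (1 + y) \<le> 1 + y / 2 - (1 / (2 * (2 + L)\<^sup>2)) * y\<^sup>2"
proof -
  define s where "s = sqrt (1 + y)"
  have s: "s \<ge> 0" "s\<^sup>2 = 1 + y" using assms(1) by (auto simp: s_def)
  have "s \<le> 1 + L"
    unfolding s_def using assms
    by (intro real_le_lsqrt) (auto simp: power2_eq_square algebra_simps intro: add_increasing)
  then have "(s + 1)\<^sup>2 \<le> (2 + L)\<^sup>2" using s by (intro power_mono) auto
  then have "(s + 1)\<^sup>2 * (s - 1)\<^sup>2 / (2 * (2 + L)\<^sup>2) \<le> (2 + L)\<^sup>2 * (s - 1)\<^sup>2 / (2 * (2 + L)\<^sup>2)"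
    by (intro divide_right_mono mult_right_mono) auto
  also have "\<dots> = (s - 1)\<^sup>2 / 2" using \<open>s \<le> 1 + L\<close> s(1) by simp
  also have "(s + 1)\<^sup>2 * (s - 1)\<^sup>2 = y\<^sup>2"
    using s(2) by (simp add: power2_eq_square algebra_simps)
  finally have "y\<^sup>2 / (2 * (2 + L)\<^sup>2) \<le> (s - 1)\<^sup>2 / 2" .
  moreover have "(s - 1)\<^sup>2 / 2 = 1 + y / 2 - s"
    using s(2) by (simp add: power2_eq_square field_simps)
  ultimately show ?thesis unfolding s_def[symmetric] by simp
qed

lemma not_summable_sum_at_top:
  fixes f :: "nat \<Rightarrow> real"
  assumes "\<And>n. 0 \<le> f n" "\<not> summable f"
  shows "filterlim (\<lambda>n. sum f {1..n}) at_top sequentially"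
  unfolding filterlim_at_top
proof
  fix Z
  \<comment> \<open>The target is raised by \<open>f 0\<close> because the sums over
    \<open>{1..n}\<close> omit index 0.\<close>
  obtain N where N: "sum f {..<N} > Z + f 0"
    using summableI_nonneg_bounded[of f "Z + f 0"] assms by (meson not_le)
  have "sum f {1..n} \<ge> Z" if "n \<ge> N" for n
  proof -
    have "sum f {..<N} \<le> sum f {..n}" using that assms by (intro sum_mono2) auto
    also have "\<dots> = f 0 + sum f {1..n}" by (simp add: sum.atMost_shift atLeast1_atMost_eq_remove0 sum.atLeast_Suc_atMost flip: atLeast0AtMost)
    finally show ?thesis using N by linarith
  qed
  then show "\<forall>\<^sub>F n in sequentially. Z \<le> sum f {1..n}"
    unfolding eventually_sequentially by blast
qed

section \<open>The bet as a function of the observations\<close>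

lemma sample_mean_minus:
  assumes "k > 0"
  shows "sample_mean x k - m = (\<Sum>i=1..k. x i - m) / real k"
  using assms by (simp add: sample_mean_def sum_subtractf field_simps)

text \<open>Moving the centre from the sample mean to \<open>m\<close> costs \<open>k\<close> times
  the squared centred mean; adding that square back after the division leaves only the correction
  with factor \<open>d\<close>. Both normalizations are thus handled at once.\<close>

lemma aGRAPA_denom_eq:
  assumes "d < k"
  shows "aGRAPA_denom d m x k =
    (real k * ((\<Sum>i=1..k. (x i - m)\<^sup>2) / real k) - real d * (sample_mean x k - m)\<^sup>2) / (real k - real d)"
proof -
  define e where "e = sample_mean x k - m"
  have k: "real k > 0" "real k - real d > 0" using assms by auto
  have sum_e: "(\<Sum>i=1..k. x i - m) = real k * e"
    using sample_mean_minus[of k x m] k by (simp add: e_def)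
  have "(\<Sum>i=1..k. (x i - sample_mean x k)\<^sup>2) = (\<Sum>i=1..k. (x i - m)\<^sup>2 - 2 * e * (x i - m) + e\<^sup>2)"
    by (intro sum.cong) (auto simp: e_def power2_eq_square algebra_simps)
  also have "\<dots> = (\<Sum>i=1..k. (x i - m)\<^sup>2) - 2 * e * (\<Sum>i=1..k. x i - m) + real k * e\<^sup>2"
    by (subst sum.distrib, subst sum_subtractf, subst sum_distrib_left) simp
  also have "\<dots> = (\<Sum>i=1..k. (x i - m)\<^sup>2) - real k * e\<^sup>2"
    by (simp only: sum_e) (simp add: power2_eq_square)
  finally show ?thesis
    using k unfolding aGRAPA_denom_def sample_var_def e_def[symmetric]
    by (simp add: field_simps)
qed

text \<open>The deterministic half of the limit theorem, for one sample point. \<open>r\<close>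
  bounds the distance of the denominator from \<open>s\<close> for either \<open>d\<close>;
  \<open>r \<le> s / 2\<close> keeps the denominator above \<open>s / 2\<close>, and the conditions
  on \<open>\<eta>\<close> then make the clipping inactive.\<close>

lemma aGRAPA_bet_close:
  fixes d k :: nat and m s \<eta> :: real and X :: "nat \<Rightarrow> 'a \<Rightarrow> real" and \<omega> :: 'a
  defines "x \<equiv> \<lambda>i. X i \<omega>"
  defines "q \<equiv> (\<Sum>i=1..k. (x i - m)\<^sup>2) / real k"
  defines "r \<equiv> (real k * \<eta> + s + \<eta>\<^sup>2) / (real k - 1)"
  assumes d: "d \<in> {0, 1}" and k: "k \<ge> 2" and s: "s > 0"
    and e: "\<bar>sample_mean x k - m\<bar> < \<eta>" and q: "\<bar>q - s\<bar> < \<eta>"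
    and r: "r \<le> s / 2" and \<eta>: "2 * \<eta> / s \<le> C / m" "2 * \<eta> / s \<le> C / (1 - m)"
  shows "\<bar>sqrt (Suc k) * aGRAPA_bet d C m U X (Suc k) \<omega>
      - (\<Sum>i=1..k. x i - m) / (sqrt k * s)\<bar> \<le> 2 * \<eta> / s + 2 * sqrt k * \<eta> * r / s\<^sup>2"
proof -
  define e where "e = sample_mean x k - m"
  define D where "D = aGRAPA_denom d m x k"
  have dk: "d < k" using d k by auto
  have "\<eta> > 0" using e by linarith
  have k1: "real k - 1 > 0" "real k - real d > 0" "real d \<le> 1" using k d by auto
  have e2: "e\<^sup>2 \<le> \<eta>\<^sup>2" using e \<open>\<eta> > 0\<close> by (simp add: e_def flip: abs_le_square_iff)
  have D: "D = (real k * q - real d * e\<^sup>2) / (real k - real d)"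
    unfolding D_def q_def e_def using dk by (rule aGRAPA_denom_eq)
  \<comment> \<open>The numerator is \<open>(real k - real d) * (D - s)\<close>, written out with
    the formula for \<open>D\<close>.\<close>
  have "\<bar>D - s\<bar> = \<bar>real k * (q - s) + real d * s - real d * e\<^sup>2\<bar> / (real k - real d)"
    using k1 by (subst abs_of_pos[OF k1(2), symmetric], subst abs_divide[symmetric])
      (simp add: D field_simps)
  also have "\<dots> \<le> (real k * \<eta> + s + \<eta>\<^sup>2) / (real k - real d)"
  proof (rule divide_right_mono)
    have "\<bar>real k * (q - s)\<bar> \<le> real k * \<eta>"
      using q by (simp add: abs_mult mult_left_mono)
    moreover have "0 \<le> real d * s" "real d * s \<le> s" "0 \<le> real d * e\<^sup>2" "real d * e\<^sup>2 \<le> e\<^sup>2"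
      using k1(3) s by (auto intro: mult_left_le_one_le)
    ultimately show "\<bar>real k * (q - s) + real d * s - real d * e\<^sup>2\<bar> \<le> real k * \<eta> + s + \<eta>\<^sup>2"
      using e2 by linarith
  qed (use k1 in simp)
  also have "\<dots> \<le> r"
    unfolding r_def using k1 s \<open>\<eta> > 0\<close> by (intro divide_left_mono mult_pos_pos) auto
  finally have Ds: "\<bar>D - s\<bar> \<le> r" .
  then have D_ge: "D \<ge> s / 2" "D > 0" using r s by auto
  have "\<bar>e / D\<bar> \<le> \<eta> / (s / 2)"
    using e D_ge s \<open>\<eta> > 0\<close> unfolding abs_divide by (intro frac_le) (auto simp: e_def)
  then have eD: "\<bar>e / D\<bar> \<le> 2 * \<eta> / s" by (simp add: mult.commute)
  have clip: "- (C / (1 - m)) \<le> e / D" "e / D \<le> C / m" using eD \<eta> by linarith+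
  have bet: "aGRAPA_bet d C m U X (Suc k) \<omega> = e / D"
    using dk D_ge clip
    by (simp add: aGRAPA_bet_def aGRAPA_defined_def clip_def Let_def flip: x_def D_def e_def)
  have "real k > 0" using k by simp
  then have Z: "(\<Sum>i=1..k. x i - m) / (sqrt k * s) = sqrt k * e / s"
    using sample_mean_minus[of k x m] s by (simp add: e_def field_simps flip: real_sqrt_mult)
  have sq: "\<bar>sqrt (Suc k) - sqrt k\<bar> \<le> 1"
  proof -
    have "sqrt (Suc k) \<le> sqrt k + 1"
      using \<open>real k > 0\<close> by (intro real_le_lsqrt) (auto simp: power2_eq_square algebra_simps)
    moreover have "sqrt k \<le> sqrt (Suc k)" by simp
    ultimately show ?thesis by linarith
  qed
  \<comment> \<open>Two sources of error are separated: replacing \<open>sqrt (Suc k)\<close> by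
    \<open>sqrt k\<close>, a change of at most 1, and replacing the random denominator
    \<open>D\<close> by its limit \<open>s\<close>.\<close>
  have "sqrt (Suc k) * (e / D) - sqrt k * e / s
      = (sqrt (Suc k) - sqrt k) * (e / D) - sqrt k * (e / D) * ((D - s) / s)"
    using D_ge s by (simp add: field_simps)
  also have "\<bar>\<dots>\<bar> \<le> \<bar>sqrt (Suc k) - sqrt k\<bar> * \<bar>e / D\<bar> + sqrt k * \<bar>e / D\<bar> * (\<bar>D - s\<bar> / s)"
    by (rule order_trans[OF abs_triangle_ineq4]) (use s in \<open>simp add: abs_mult\<close>)
  also have "\<dots> \<le> 1 * (2 * \<eta> / s) + sqrt k * (2 * \<eta> / s) * (r / s)"
    using sq eD Ds s \<open>\<eta> > 0\<close> by (intro add_mono mult_mono divide_right_mono) auto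
  finally show ?thesis unfolding bet Z by (simp add: power2_eq_square mult_ac)
qed

section \<open>Independent observations in the unit interval\<close>

locale iid_unit_interval = prob_space M for M :: "'a measure" +
  fixes X :: "nat \<Rightarrow> 'a \<Rightarrow> real" and P :: "real measure" and m \<sigma> :: real
  assumes indep: "indep_vars (\<lambda>_. borel) X {1..}"
    and dist: "\<And>n. n \<ge> 1 \<Longrightarrow> distr M borel (X n) = P"
    and unit: "measure P {0..1} = 1"
    and mean: "m = (\<integral>x. x \<partial>P)"
    and var: "\<sigma>\<^sup>2 = (\<integral>x. (x - m)\<^sup>2 \<partial>P)"
    and \<sigma>_pos: "\<sigma> > 0"
begin

lemma X_meas: "n \<ge> 1 \<Longrightarrow> X n \<in> borel_measurable M"
  using indep by (auto simp: indep_vars_def)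

lemma real_distribution_P: "real_distribution P"
  using dist[of 1] real_distribution_distr[OF X_meas[of 1]] by simp

sublocale P: real_distribution P by (rule real_distribution_P)

lemma AE_P: "AE x in P. x \<in> {0..1}"
  using unit by (rule P.AE_prob_1)

lemma AE_unit:
  assumes "n \<ge> 1"
  shows "AE \<omega> in M. X n \<omega> \<in> {0..1}"
  using AE_P unfolding dist[OF assms, symmetric] by (rule AE_distrD[OF X_meas[OF assms]])

lemma AE_unit_all: "AE \<omega> in M. \<forall>n\<ge>1. X n \<omega> \<in> {0..1}"
  using AE_unit by (simp add: AE_all_countable)

lemma expectation_X:
  assumes "n \<ge> 1" "h \<in> borel_measurable borel"
  shows "expectation (\<lambda>\<omega>. h (X n \<omega>) :: real) = (\<integral>x. h x \<partial>P)"
  using assms X_meas[of n] by (subst dist[symmetric, of n]) (auto simp: integral_distr)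

lemma integrable_P:
  fixes h :: "real \<Rightarrow> real"
  assumes "h \<in> borel_measurable borel" "\<And>x. x \<in> {0..1} \<Longrightarrow> \<bar>h x\<bar> \<le> B"
  shows "integrable P h"
  using AE_P assms by (intro P.integrable_const_bound[where B=B]) (auto elim: eventually_mono)

lemma integrable_X:
  fixes h :: "real \<Rightarrow> real"
  assumes "n \<ge> 1" "h \<in> borel_measurable borel" "\<And>x. x \<in> {0..1} \<Longrightarrow> \<bar>h x\<bar> \<le> B"
  shows "integrable M (\<lambda>\<omega>. h (X n \<omega>))"
  using integrable_P[OF assms(2,3)] assms(1) X_meas[of n] dist[of n] assms(2)
  by (metis integrable_distr_eq)

text \<open>On the unit interval x^2 \<le> x, hence
  \<open>\<sigma>\<^sup>2 \<le> m * (1 - m)\<close>. A positive variance therefore forces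
  \<open>m\<close> strictly inside the interval, so that \<open>C / m\<close> and
  \<open>C / (1 - m)\<close> are genuine positive bounds.\<close>

lemma m_01: "0 < m" "m < 1" and sigma_le_1: "\<sigma>\<^sup>2 \<le> 1"
proof -
  have int: "integrable P (\<lambda>x. x)" by (rule integrable_P[where B=1]) auto
  have "\<sigma>\<^sup>2 \<le> (\<integral>x. x - 2 * m * x + m\<^sup>2 \<partial>P)"
    unfolding var
  proof (rule integral_mono_AE)
    show "integrable P (\<lambda>x. (x - m)\<^sup>2)"
    proof (rule integrable_P[where B="(1 + \<bar>m\<bar>)\<^sup>2"])
      show "\<bar>(x - m)\<^sup>2\<bar> \<le> (1 + \<bar>m\<bar>)\<^sup>2" if "x \<in> {0..1}" for x
        using that by (auto simp flip: abs_le_square_iff)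
    qed simp
    show "AE x in P. (x - m)\<^sup>2 \<le> x - 2 * m * x + m\<^sup>2"
      using AE_P
    proof eventually_elim
      case (elim x)
      then have "x * x \<le> x" by (simp add: mult_left_le)
      then show ?case by (simp add: power2_eq_square algebra_simps)
    qed
  qed (use int in simp)
  also have "\<dots> = m * (1 - m)"
    using int P.prob_space by (simp add: mean[symmetric] power2_eq_square algebra_simps)
  finally have le: "\<sigma>\<^sup>2 \<le> m * (1 - m)" .
  moreover have "\<sigma>\<^sup>2 > 0" using \<sigma>_pos by simp
  ultimately have "m * (1 - m) > 0" by linarith
  then show "0 < m" "m < 1" by (auto simp: zero_less_mult_iff)
  then have "m * (1 - m) \<le> 1 * 1" by (intro mult_mono) auto
  with le show "\<sigma>\<^sup>2 \<le> 1" by simp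
qed

lemma AE_centered: "AE \<omega> in M. \<forall>n\<ge>1. \<bar>X n \<omega> - m\<bar> \<le> 1"
  using AE_unit_all
proof eventually_elim
  case (elim \<omega>)
  then have "X n \<omega> \<in> {0..1}" if "n \<ge> 1" for n using that by blast
  then show ?case using m_01 by (fastforce simp: abs_le_iff)
qed

section \<open>The filtration generated by the past observations\<close>

lemma past_gen: "{X i -` A \<inter> space M | i A. i \<in> {1..<n} \<and> A \<in> sets borel} \<subseteq> Pow (space M)"
  by auto

lemma space_past [simp]: "space (past M X n) = space M"
  using past_gen unfolding past_def by (rule space_measure_of)

lemma sets_past: "sets (past M X n) =
    sigma_sets (space M) {X i -` A \<inter> space M | i A. i \<in> {1..<n} \<and> A \<in> sets borel}"
  using past_gen unfolding past_def by (rule sets_measure_of)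

lemma subalgebra_past: "subalgebra M (past M X n)"
  unfolding subalgebra_def
proof
  show "sets (past M X n) \<subseteq> events"
    unfolding sets_past by (rule sets.sigma_sets_subset) (auto intro!: measurable_sets[OF X_meas])
qed simp

lemma past_mono: "n \<le> n' \<Longrightarrow> sets (past M X n) \<subseteq> sets (past M X n')"
  unfolding sets_past by (rule sigma_sets_mono') (auto intro: less_le_trans)

lemma X_past: "1 \<le> i \<Longrightarrow> i < n \<Longrightarrow> X i \<in> borel_measurable (past M X n)"
  by (rule measurableI) (auto simp: sets_past intro!: sigma_sets.Basic)

lemma past_meas: "G \<in> borel_measurable (past M X n) \<Longrightarrow> G \<in> borel_measurable M"
  by (rule measurable_from_subalg[OF subalgebra_past])

lemma measurable_past_mono:
  "n \<le> n' \<Longrightarrow> G \<in> borel_measurable (past M X n) \<Longrightarrow> G \<in> borel_measurable (past M X n')"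
  using past_mono[of n n'] by (auto simp: measurable_def)

text \<open>The preimages under single observations form intersection-stable families, so the
  sigma-algebras generated by disjoint blocks of indices are independent. \<open>G\<close> lives on
  the block before \<open>n\<close>, the other variable on the block \<open>{n}\<close>.\<close>

lemma indep_past:
  assumes n: "n \<ge> 1" and G: "G \<in> borel_measurable (past M X n)" and h: "h \<in> borel_measurable borel"
  shows "indep_var borel G borel (\<lambda>\<omega>. h (X n \<omega>))"
proof -
  let ?E = "\<lambda>i. {X i -` A \<inter> space M | A. A \<in> sets borel}"
  have Int_stable: "Int_stable (?E i)" for i
  proof (rule Int_stableI)
    fix a b assume "a \<in> ?E i" "b \<in> ?E i"
    then obtain A B where "a = X i -` A \<inter> space M" "b = X i -` B \<inter> space M" "A \<in> sets borel" "B \<in> sets borel"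
      by blast
    then have "a \<inter> b = X i -` (A \<inter> B) \<inter> space M" "A \<inter> B \<in> sets borel" by auto
    then show "a \<inter> b \<in> ?E i" by blast
  qed
  have "indep_sets ?E {1..}" using indep by (simp add: indep_vars_def2)
  \<comment> \<open>The two blocks are indexed by the Booleans: \<open>True\<close> for the past,
    \<open>False\<close> for the present.\<close>
  then have "indep_sets ?E (\<Union>j\<in>UNIV. case_bool {1..<n} {n} j)"
    by (rule indep_sets_mono_index[rotated]) (use n in \<open>auto simp: UNIV_bool\<close>)
  then have "indep_sets (\<lambda>j. sigma_sets (space M) (\<Union>i\<in>case_bool {1..<n} {n} j. ?E i)) UNIV"
    by (rule indep_sets_collect_sigma)
      (auto simp: disjoint_family_on_def Int_stable split: bool.splits)
  moreover have "sigma_sets (space M) {G -` A \<inter> space M | A. A \<in> sets borel}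
      \<subseteq> sigma_sets (space M) (\<Union>i\<in>{1..<n}. ?E i)"
  proof (rule sigma_sets_mono)
    have *: "(\<Union>i\<in>{1..<n}. ?E i) = {X i -` A \<inter> space M | i A. i \<in> {1..<n} \<and> A \<in> sets borel}" by blast
    then show "{G -` A \<inter> space M | A. A \<in> sets borel} \<subseteq> sigma_sets (space M) (\<Union>i\<in>{1..<n}. ?E i)"
      unfolding * sets_past[symmetric] using measurable_sets[OF G] by auto
  qed
  moreover have "sigma_sets (space M) {(\<lambda>\<omega>. h (X n \<omega>)) -` A \<inter> space M | A. A \<in> sets borel}
      \<subseteq> sigma_sets (space M) (?E n)"
  proof (rule sigma_sets_mono, safe)
    fix A :: "'b set" assume "A \<in> sets borel"
    then have "h -` A \<in> sets borel" using measurable_sets[OF h] by simp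
    moreover have "(\<lambda>\<omega>. h (X n \<omega>)) -` A \<inter> space M = X n -` (h -` A) \<inter> space M" by auto
    ultimately show "(\<lambda>\<omega>. h (X n \<omega>)) -` A \<inter> space M \<in> sigma_sets (space M) (?E n)"
      by (intro sigma_sets.Basic) blast
  qed
  ultimately have "indep_set (sigma_sets (space M) {G -` A \<inter> space M | A. A \<in> sets borel})
      (sigma_sets (space M) {(\<lambda>\<omega>. h (X n \<omega>)) -` A \<inter> space M | A. A \<in> sets borel})"
    unfolding indep_set_def
    by (elim indep_sets_mono_sets) (auto split: bool.split)
  then show ?thesis
    using past_meas[OF G] X_meas[OF n] h by (simp add: indep_var_eq)
qed

text \<open>Independence of the past and the present makes the expectation of the product factor.
  This replaces pulling \<open>G\<close> out of a conditional expectation.\<close>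

lemma expectation_past_mult:
  fixes h :: "real \<Rightarrow> real"
  assumes "n \<ge> 1" "G \<in> borel_measurable (past M X n)" "integrable M G"
    and "h \<in> borel_measurable borel" "\<And>x. x \<in> {0..1} \<Longrightarrow> \<bar>h x\<bar> \<le> B"
  shows "expectation (\<lambda>\<omega>. G \<omega> * h (X n \<omega>)) = expectation G * (\<integral>x. h x \<partial>P)"
    and "integrable M (\<lambda>\<omega>. G \<omega> * h (X n \<omega>))"
  using indep_var_lebesgue_integral[OF indep_past[of n G h] assms(3) integrable_X[of n h B]]
    indep_var_integrable[OF indep_past[of n G h] assms(3) integrable_X[of n h B]]
    expectation_X[of n h] assms by auto

text \<open>The values lie in an interval of length 2, so the usual exponent
  \<open>- 2 * k * \<eta>\<^sup>2 / 2\<^sup>2\<close> simplifies to the one stated.\<close>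

lemma Hoeffding:
  assumes h [measurable]: "h \<in> borel_measurable borel" and h01: "\<And>x. x \<in> {0..1} \<Longrightarrow> \<bar>h x\<bar> \<le> 1"
    and k: "k \<ge> 1" and \<eta>: "\<eta> \<ge> 0"
  shows "prob {\<omega> \<in> space M. \<bar>(\<Sum>i=1..k. h (X i \<omega>)) / k - (\<integral>x. h x \<partial>P)\<bar> \<ge> \<eta>}
    \<le> 2 * exp (- (k * \<eta>\<^sup>2 / 2))"
proof -
  interpret H: Hoeffding_ineq_iid M "{1..k}" "\<lambda>i \<omega>. h (X i \<omega>)" "\<lambda>\<omega>. h (X 1 \<omega>)" "-1" 1
    "expectation (\<lambda>\<omega>. h (X 1 \<omega>))"
  proof unfold_locales
    show "indep_vars (\<lambda>_. borel) (\<lambda>i \<omega>. h (X i \<omega>)) {1..k}"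
      by (rule indep_vars_compose2[OF indep_vars_subset[OF indep]]) auto
    have [measurable]: "X i \<in> borel_measurable M" if "i \<ge> 1" for i using that by (rule X_meas)
    have "distr M borel (\<lambda>\<omega>. h (X i \<omega>)) = distr P borel h" if "i \<ge> 1" for i
      using that by (subst dist[symmetric, of i]) (auto simp: distr_distr comp_def)
    then show "distr M borel (\<lambda>\<omega>. h (X i \<omega>)) = distr M borel (\<lambda>\<omega>. h (X 1 \<omega>))" if "i \<in> {1..k}" for i
      using that by simp
    show "AE \<omega> in M. h (X 1 \<omega>) \<in> {-1..1}"
      using AE_unit[OF order_refl]
    proof eventually_elim
      case (elim \<omega>)
      then show ?case using h01[OF elim] by (auto simp: abs_le_iff)
    qed
  qed (use X_meas[of 1] in auto)
  have "prob {\<omega> \<in> space M. \<bar>(\<Sum>i=1..k. h (X i \<omega>)) / real (card {1..k}) - expectation (\<lambda>\<omega>. h (X 1 \<omega>))\<bar> \<ge> \<eta>}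
      \<le> 2 * exp (- 2 * real (card {1..k}) * \<eta>\<^sup>2 / (1 - (-1))\<^sup>2)"
    using k \<eta> by (intro H.Hoeffding_ineq_abs_ge') auto
  then show ?thesis using expectation_X[of 1 h] by simp
qed

text \<open>The classical theorem for the observations reindexed from 0 has a standard normal limit;
  a further factor \<open>1 / \<sigma>\<close> turns the normalization into the one that arises from
  dividing the sample mean by the variance.\<close>

lemma CLT:
  "weak_conv_m (\<lambda>k. distr M borel (\<lambda>\<omega>. (\<Sum>i=1..k. X i \<omega> - m) / (sqrt k * \<sigma>\<^sup>2)))
    (density lborel (normal_density 0 (1 / \<sigma>)))"
proof -
  let ?X = "\<lambda>i. X (Suc i)"
  have ind: "indep_vars (\<lambda>_. borel) ?X UNIV"
    by (rule indep_vars_reindex)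
      (use indep greaterThan_0 atLeast_Suc_greaterThan[of 0] in simp_all)
  have E: "expectation (?X n) = m" for n
    using expectation_X[of "Suc n" "\<lambda>x. x"] by (simp add: mean)
  have V: "variance (?X n) = \<sigma>\<^sup>2" for n
    using expectation_X[of "Suc n" "\<lambda>x. (x - m)\<^sup>2"] by (simp add: E var)
  have "weak_conv_m (\<lambda>n. distr M borel (\<lambda>x. (\<Sum>i<n. ?X i x - m) / sqrt (n * \<sigma>\<^sup>2))) std_normal_distribution"
    by (rule central_limit_theorem[OF ind E \<sigma>_pos _ V])
      (auto intro!: integrable_X[of _ "\<lambda>x. x\<^sup>2" 1] dist simp: power_le_one)
  then have "weak_conv_m (\<lambda>n. distr M borel (\<lambda>x. 1 / \<sigma> * ((\<Sum>i<n. ?X i x - m) / sqrt (n * \<sigma>\<^sup>2))))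
      (density lborel (normal_density 0 (1 / \<sigma>)))"
    by (intro weak_conv_m_scale_std_normal prob_space_axioms)
      (use \<sigma>_pos in \<open>auto intro!: borel_measurable_divide borel_measurable_sum borel_measurable_diff X_meas\<close>)
  also have "(\<lambda>n x. 1 / \<sigma> * ((\<Sum>i<n. ?X i x - m) / sqrt (n * \<sigma>\<^sup>2)))
      = (\<lambda>k \<omega>. (\<Sum>i=1..k. X i \<omega> - m) / (sqrt k * \<sigma>\<^sup>2))"
    using \<sigma>_pos
    by (intro ext) (simp add: real_sqrt_mult power2_eq_square sum.atLeast1_atMost_eq lessThan_atLeast0 field_simps)
  finally show ?thesis .
qed

section \<open>Measurability, bounds and asymptotics of the bet\<close>

lemma bet_meas_past:
  assumes n: "n \<ge> 1" and [measurable]: "U n \<in> borel_measurable (past M X n)"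
  shows "aGRAPA_bet d C m U X n \<in> borel_measurable (past M X n)"
proof -
  define k where "k = n - 1"
  have [measurable]: "X i \<in> borel_measurable (past M X n)" if "i \<in> {1..k}" for i
    using that n by (intro X_past) (auto simp: k_def)
  have [measurable]: "(\<lambda>\<omega>. sample_mean (\<lambda>i. X i \<omega>) k) \<in> borel_measurable (past M X n)"
    unfolding sample_mean_def by measurable
  have [measurable]: "(\<lambda>\<omega>. aGRAPA_denom d m (\<lambda>i. X i \<omega>) k) \<in> borel_measurable (past M X n)"
    unfolding aGRAPA_denom_def sample_var_def by measurable
  show ?thesis
    unfolding aGRAPA_bet_def[abs_def] Let_def aGRAPA_defined_def clip_def k_def[symmetric]
    by measurable
qed

text \<open>\<open>clip\<close> respects its upper bound only if the lower bound does not exceed it;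
  here they have opposite signs because \<open>m\<close> lies strictly between 0 and 1.\<close>

lemma bet_bounds:
  assumes "C > 0" "U n \<omega> \<in> {- (C / (1 - m))..C / m}"
  shows "aGRAPA_bet d C m U X n \<omega> \<in> {- (C / (1 - m))..C / m}"
proof -
  have "C / (1 - m) > 0" "C / m > 0" using assms(1) m_01 by auto
  then have "- (C / (1 - m)) \<le> C / m" by linarith
  then show ?thesis using assms(2) by (simp add: aGRAPA_bet_def Let_def clip_def)
qed

lemma real_distribution_normal:
  "real_distribution (density lborel (normal_density 0 (1 / \<sigma>)))"
  using \<sigma>_pos prob_space_normal_density[of "1 / \<sigma>" 0]
  by (auto simp: real_distribution_def real_distribution_axioms_def)

lemma bet_weak_conv:
  assumes C: "C > 0" and d: "d \<in> {0, 1}"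
    and U: "\<And>n. n \<ge> 1 \<Longrightarrow> U n \<in> borel_measurable (past M X n)"
  shows "weak_conv_m
           (\<lambda>n. distr M borel (\<lambda>\<omega>. sqrt (real n) * aGRAPA_bet d C m U X n \<omega>))
           (density lborel (normal_density 0 (1 / \<sigma>)))"
proof -
  let ?N = "density lborel (normal_density 0 (1 / \<sigma>))"
  \<comment> \<open>The index counts observations: \<open>k\<close> of them determine the bet of
    round \<open>Suc k\<close>.\<close>
  let ?Y = "\<lambda>k \<omega>. sqrt (real (Suc k)) * aGRAPA_bet d C m U X (Suc k) \<omega>"
  let ?Z = "\<lambda>k \<omega>. (\<Sum>i=1..k. X i \<omega> - m) / (sqrt k * \<sigma>\<^sup>2)"
  let ?q = "\<lambda>k \<omega>. (\<Sum>i=1..k. (X i \<omega> - m)\<^sup>2) / real k"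
  define s where "s = \<sigma>\<^sup>2"
  have s: "s > 0" using \<sigma>_pos by (simp add: s_def)
  \<comment> \<open>Any exponent strictly between -1/2 and -1/4 would do:
    \<open>k * \<eta>\<^sup>2\<close> must tend to infinity for Hoeffding's bound to vanish, and
    \<open>sqrt k * \<eta>\<^sup>2\<close> must tend to 0 for the comparison error to vanish,
    \<open>r\<close> being of order \<open>\<eta>\<close>.\<close>
  define \<eta> where "\<eta> k = real k powr (- 1 / 3)" for k
  define r where "r k = (real k * \<eta> k + s + (\<eta> k)\<^sup>2) / (real k - 1)" for k
  have [measurable]: "X i \<in> borel_measurable M" if "i \<ge> 1" for i using that by (rule X_meas)
  have [measurable]: "aGRAPA_bet d C m U X (Suc k) \<in> borel_measurable M" for k
    using bet_meas_past[of "Suc k" U] U[of "Suc k"] by (intro past_meas) auto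
  have lim_\<eta>: "\<eta> \<longlonglongrightarrow> 0" unfolding \<eta>_def by real_asymp
  have lim_r: "r \<longlonglongrightarrow> 0" unfolding r_def \<eta>_def using s by real_asymp
  have lim_\<kappa>: "(\<lambda>k. 2 * \<eta> k / s + 2 * sqrt (real k) * \<eta> k * r k / s\<^sup>2) \<longlonglongrightarrow> 0"
    unfolding r_def \<eta>_def using s by real_asymp
  have lim_\<eta>s: "(\<lambda>k. 2 * \<eta> k / s) \<longlonglongrightarrow> 0" unfolding \<eta>_def using s by real_asymp
  have lim_p: "(\<lambda>k. 4 * exp (- (real k * (\<eta> k)\<^sup>2 / 2))) \<longlonglongrightarrow> 0" unfolding \<eta>_def by real_asymp
  have "weak_conv_m (\<lambda>k. distr M borel (?Y k)) ?N"
  proof (rule weak_conv_m_of_close[OF _ _ _ CLT])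
    show "?Y k \<in> borel_measurable M" "?Z k \<in> borel_measurable M" for k by measurable
    show "real_distribution ?N" by (rule real_distribution_normal)
    fix \<epsilon> :: real assume \<epsilon>: "\<epsilon> > 0"
    have Cm: "C / m > 0" "C / (1 - m) > 0" using C m_01 by auto
    have "\<forall>\<^sub>F k in sequentially. prob {\<omega> \<in> space M. \<epsilon> < \<bar>?Y k \<omega> - ?Z k \<omega>\<bar>}
        \<le> 4 * exp (- (real k * (\<eta> k)\<^sup>2 / 2))"
      using eventually_ge_at_top[of 2] order_tendstoD(2)[OF lim_r, of "s / 2", OF half_gt_zero[OF s]]
        order_tendstoD(2)[OF lim_\<kappa> \<epsilon>] order_tendstoD(2)[OF lim_\<eta>s Cm(1)] order_tendstoD(2)[OF lim_\<eta>s Cm(2)]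
    proof eventually_elim
      case (elim k)
      let ?A = "{\<omega> \<in> space M. \<eta> k \<le> \<bar>(\<Sum>i=1..k. X i \<omega>) / k - (\<integral>x. x \<partial>P)\<bar>}"
      let ?B = "{\<omega> \<in> space M. \<eta> k \<le> \<bar>?q k \<omega> - (\<integral>x. (x - m)\<^sup>2 \<partial>P)\<bar>}"
      have "prob {\<omega> \<in> space M. \<epsilon> < \<bar>?Y k \<omega> - ?Z k \<omega>\<bar>} \<le> prob (?A \<union> ?B)"
      proof (rule finite_measure_mono)
        show "{\<omega> \<in> space M. \<epsilon> < \<bar>?Y k \<omega> - ?Z k \<omega>\<bar>} \<subseteq> ?A \<union> ?B"
        \<comment> \<open>Off the two Hoeffding events both empirical moments are within
          \<open>\<eta> k\<close> of their limits, so the deterministic comparison applies and its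
          error is eventually below \<open>\<epsilon>\<close>.\<close>
        proof (rule subsetI, rule ccontr)
          fix \<omega> assume \<omega>: "\<omega> \<in> {\<omega> \<in> space M. \<epsilon> < \<bar>?Y k \<omega> - ?Z k \<omega>\<bar>}" "\<omega> \<notin> ?A \<union> ?B"
          then have "\<bar>sample_mean (\<lambda>i. X i \<omega>) k - m\<bar> < \<eta> k" "\<bar>?q k \<omega> - s\<bar> < \<eta> k"
            by (auto simp: sample_mean_def mean[symmetric] var[symmetric] s_def)
          then have "\<bar>?Y k \<omega> - ?Z k \<omega>\<bar> \<le> 2 * \<eta> k / s + 2 * sqrt (real k) * \<eta> k * r k / s\<^sup>2"
            unfolding r_def s_def[symmetric] using elim s d
            by (intro aGRAPA_bet_close) (auto simp: r_def)
          with \<omega>(1) elim show False by simp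
        qed
        show "?A \<union> ?B \<in> events" by measurable
      qed
      also have "\<dots> \<le> prob ?A + prob ?B" by (rule measure_Un_le) measurable
      also have "\<dots> \<le> 2 * exp (- (real k * (\<eta> k)\<^sup>2 / 2)) + 2 * exp (- (real k * (\<eta> k)\<^sup>2 / 2))"
      proof (rule add_mono)
        show "prob ?A \<le> 2 * exp (- (real k * (\<eta> k)\<^sup>2 / 2))"
          using elim by (intro Hoeffding) (auto simp: \<eta>_def)
        have "\<bar>(x - m)\<^sup>2\<bar> \<le> 1" if "x \<in> {0..1}" for x
          using that m_01 by (auto simp: abs_square_le_1 abs_le_iff)
        then show "prob ?B \<le> 2 * exp (- (real k * (\<eta> k)\<^sup>2 / 2))"
          using elim by (intro Hoeffding) (auto simp: \<eta>_def)
      qed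
      finally show ?case by simp
    qed
    then show "(\<lambda>k. prob {\<omega> \<in> space M. \<epsilon> < \<bar>?Y k \<omega> - ?Z k \<omega>\<bar>}) \<longlonglongrightarrow> 0"
      by (intro tendsto_sandwich[OF _ _ tendsto_const lim_p]) auto
  qed
  then show ?thesis
    unfolding weak_conv_m_def weak_conv_def by (auto intro: LIMSEQ_imp_Suc)
qed

text \<open>The normal limit has no atoms, so the bet scaled by \<open>sqrt n\<close> is bounded
  away from 0 in probability; undoing the scaling gives the rate.\<close>

lemma bet_Omega_p:
  assumes C: "C > 0" and d: "d \<in> {0, 1}"
    and U: "\<And>n. n \<ge> 1 \<Longrightarrow> U n \<in> borel_measurable (past M X n)"
  shows "Omega_p M (aGRAPA_bet d C m U X) (\<lambda>n. real n powr (- 1 / 2))"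
proof -
  let ?b = "aGRAPA_bet d C m U X"
  let ?N = "density lborel (normal_density 0 (1 / \<sigma>))"
  let ?Y = "\<lambda>n \<omega>. sqrt (real n) * ?b n \<omega>"
  \<comment> \<open>At index 0 the bet is \<open>U 0\<close>, about which nothing is known, but the
    factor \<open>sqrt 0\<close> makes the product the zero function.\<close>
  have meas: "?Y n \<in> borel_measurable M" for n
  proof (cases "n = 0")
    case False
    then show ?thesis
      using bet_meas_past[of n U] U[of n] by (intro borel_measurable_times past_meas[of _ n]) auto
  qed simp
  have "AE y in lborel. y \<in> {x} \<longrightarrow> ennreal (normal_density 0 (1 / \<sigma>) y) = 0" for x
    using AE_lborel_singleton[of x] by eventually_elim simp
  then have "{x} \<in> null_sets ?N" for x
    by (simp add: null_sets_density_iff)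
  then have "measure ?N {x} = 0" for x
    by (simp add: measure_def null_setsD1)
  then have Y: "Omega_p M ?Y (\<lambda>_. 1)"
    using bet_weak_conv[OF assms]
    by (intro Omega_p_of_weak_conv[where \<mu>="?N"] meas real_distribution_normal)
  have iff: "\<delta> * real n powr (- 1 / 2) \<le> \<bar>?b n \<omega>\<bar> \<longleftrightarrow> \<delta> * 1 \<le> \<bar>?Y n \<omega>\<bar>" if "n > 0" for n \<delta> \<omega>
  proof -
    have *: "real n powr (- 1 / 2) = inverse (sqrt n)"
      using that by (simp add: powr_minus powr_half_sqrt)
    show ?thesis unfolding * using that by (simp add: abs_mult field_simps)
  qed
  from eventually_gt_at_top[of 0]
  have "\<forall>\<^sub>F n in sequentially. \<forall>\<omega>\<in>space M. \<delta> * real n powr (- 1 / 2) \<le> \<bar>?b n \<omega>\<bar>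
      \<longleftrightarrow> \<delta> * 1 \<le> \<bar>?Y n \<omega>\<bar>" for \<delta>
    by eventually_elim (intro ballI iff)
  with Y show ?thesis by (rule Omega_p_transfer)
qed

end

section \<open>The wealth process\<close>

text \<open>The factor \<open>Q n\<close> dominates \<open>sqrt (1 + lam n * (X n - m))\<close> and, being quadratic in \<open>X n - m\<close>,
  has conditional mean exactly \<open>q n\<close> given the past, so no conditional expectations are needed.\<close>
lemma (in iid_unit_interval) wealth_tendsto_0:
  assumes lam: "\<And>n. n \<ge> 1 \<Longrightarrow> lam n \<in> borel_measurable (past M X n)"
    and L: "\<And>n \<omega>. n \<ge> 1 \<Longrightarrow> \<omega> \<in> space M \<Longrightarrow> \<bar>lam n \<omega>\<bar> \<le> L"
    and ge: "AE \<omega> in M. \<forall>n\<ge>1. lam n \<omega> * (X n \<omega> - m) \<ge> -1"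
    and Omega: "Omega_p M lam (\<lambda>n. real n powr (- 1 / 2))"
  shows "AE \<omega> in M. (\<lambda>n. wealth m lam X n \<omega>) \<longlonglongrightarrow> 0"
proof -
  obtain \<omega>0 where "\<omega>0 \<in> space M" using not_empty by blast
  then have L0: "L \<ge> 0" using L[of 1 \<omega>0] by simp
  \<comment> \<open>The constant of \<open>sqrt_one_plus_le\<close> for \<open>y\<close> bounded by
    \<open>L\<close>. As \<open>c * L\<^sup>2 \<le> 1 / 2\<close> and
    \<open>\<sigma>\<^sup>2 \<le> 1\<close>, each \<open>q n\<close> is at least 1/2 and may be
    divided by.\<close>
  define c where "c = 1 / (2 * (2 + L)\<^sup>2)"
  have "L\<^sup>2 \<le> (2 + L)\<^sup>2" using L0 by (intro power_mono) auto
  then have c: "c > 0" "c * L\<^sup>2 \<le> 1 / 2" using L0 by (auto simp: c_def field_simps)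
  define Q where "Q n \<omega> = 1 + lam n \<omega> * (X n \<omega> - m) / 2 - c * (lam n \<omega> * (X n \<omega> - m))\<^sup>2" for n \<omega>
  define q where "q n \<omega> = 1 - c * \<sigma>\<^sup>2 * (lam n \<omega>)\<^sup>2" for n \<omega>
  \<comment> \<open>Dividing each factor by its conditional mean makes the product a martingale with
    \<open>V 0 = 1\<close>.\<close>
  define V where "V n \<omega> = (\<Prod>k=1..n. Q k \<omega> / q k \<omega>)" for n \<omega>
  have lam_sq: "(lam n \<omega>)\<^sup>2 \<le> L\<^sup>2" if "n \<ge> 1" "\<omega> \<in> space M" for n \<omega>
    using L[OF that] L0 by (simp flip: abs_le_square_iff)
  have q: "q n \<omega> \<ge> 1 / 2" if "n \<ge> 1" "\<omega> \<in> space M" for n \<omega>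
  proof -
    have "c * (\<sigma>\<^sup>2 * (lam n \<omega>)\<^sup>2) \<le> c * (1 * L\<^sup>2)"
      using lam_sq[OF that] sigma_le_1 c by (intro mult_left_mono mult_mono) auto
    then show ?thesis using c(2) unfolding q_def by (simp only: mult.assoc mult_1)
  qed
  have AE_y: "AE \<omega> in M. \<forall>n\<ge>1. \<bar>lam n \<omega> * (X n \<omega> - m)\<bar> \<le> L"
    using AE_centered AE_space
  proof eventually_elim
    case (elim \<omega>)
    have "\<bar>lam n \<omega>\<bar> * \<bar>X n \<omega> - m\<bar> \<le> L * 1" if "n \<ge> 1" for n
      using elim L[of n \<omega>] that L0 by (intro mult_mono) auto
    then show ?case by (simp add: abs_mult)
  qed
  have AE_Q: "AE \<omega> in M. \<forall>n\<ge>1. sqrt (1 + lam n \<omega> * (X n \<omega> - m)) \<le> Q n \<omega>"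
    using AE_y ge
  proof eventually_elim
    case (elim \<omega>)
    show ?case
    proof (intro allI impI)
      fix n :: nat assume "n \<ge> 1"
      then have "\<bar>lam n \<omega> * (X n \<omega> - m)\<bar> \<le> L" "- 1 \<le> lam n \<omega> * (X n \<omega> - m)"
        using elim by blast+
      then show "sqrt (1 + lam n \<omega> * (X n \<omega> - m)) \<le> Q n \<omega>"
        unfolding Q_def c_def using L0 by (intro sqrt_one_plus_le) linarith+
    qed
  qed
  have AE_nonneg: "AE \<omega> in M. \<forall>n\<ge>1. 0 \<le> Q n \<omega>"
    using AE_Q ge
  proof eventually_elim
    case (elim \<omega>)
    show ?case
    proof (intro allI impI)
      fix n :: nat assume "n \<ge> 1"
      then have "0 \<le> sqrt (1 + lam n \<omega> * (X n \<omega> - m))" "sqrt (1 + lam n \<omega> * (X n \<omega> - m)) \<le> Q n \<omega>"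
        using elim by (force, blast)
      then show "0 \<le> Q n \<omega>" by linarith
    qed
  qed
  \<comment> \<open>A crude bound: the numerator is at most \<open>1 + L\<close> and the denominator
    at least 1/2. It only has to make every \<open>V n\<close> bounded, hence integrable.\<close>
  define B where "B = 2 * (1 + L + L\<^sup>2)"
  have AE_B: "AE \<omega> in M. \<forall>n. \<bar>V n \<omega>\<bar> \<le> B ^ n"
    using AE_nonneg AE_y AE_space
  proof eventually_elim
    case (elim \<omega>)
    have "\<bar>Q k \<omega> / q k \<omega>\<bar> \<le> B" if "k \<ge> 1" for k
    proof -
      have y: "\<bar>lam k \<omega> * (X k \<omega> - m)\<bar> \<le> L" using elim that by blast
      have qk: "q k \<omega> \<ge> 1 / 2" using q elim that by blast
      have "0 \<le> c * (lam k \<omega> * (X k \<omega> - m))\<^sup>2" using c by simp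
      then have "Q k \<omega> \<le> 1 + L" using y L0 unfolding Q_def by linarith
      then have "\<bar>Q k \<omega>\<bar> / \<bar>q k \<omega>\<bar> \<le> (1 + L) / (1 / 2)"
        using qk elim(1) that L0 by (intro frac_le) auto
      also have "\<dots> \<le> B" by (simp add: B_def)
      finally show ?thesis by simp
    qed
    then have "(\<Prod>k=1..n. \<bar>Q k \<omega> / q k \<omega>\<bar>) \<le> (\<Prod>k=1..n. B)" for n
      by (intro prod_mono) auto
    then show ?case by (simp add: V_def abs_prod)
  qed
  have V_past: "V n \<in> borel_measurable (past M X (Suc n))" for n
  proof -
    have [measurable]: "lam k \<in> borel_measurable (past M X (Suc n))" "X k \<in> borel_measurable (past M X (Suc n))"
      if "k \<in> {1..n}" for k
      using that lam[of k] by (auto intro: X_past measurable_past_mono[of k])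
    show ?thesis unfolding V_def[abs_def] Q_def q_def by measurable
  qed
  have int_V: "integrable M (V n)" for n
    using AE_B past_meas[OF V_past] by (intro integrable_const_bound[where B="B ^ n"]) (auto elim: eventually_mono)
  \<comment> \<open>\<open>G\<close> collects what is known before round \<open>Suc n\<close>. When
    \<open>Q\<close> is expanded, the linear term integrates to 0 because \<open>m\<close> is the
    mean, and the quadratic term produces the factor \<open>\<sigma>\<^sup>2\<close>. What remains
    is \<open>G * q (Suc n)\<close>, which is \<open>V n\<close> on \<open>A\<close>.\<close>
  have step: "(\<integral>\<omega>. V (Suc n) \<omega> * indicator A \<omega> \<partial>M) = (\<integral>\<omega>. V n \<omega> * indicator A \<omega> \<partial>M)"
    if A[measurable]: "A \<in> sets (past M X (Suc n))" for n A
  proof -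
    let ?F = "past M X (Suc n)"
    define l where "l = lam (Suc n)"
    define G where "G \<omega> = V n \<omega> * indicator A \<omega> / q (Suc n) \<omega>" for \<omega>
    have [measurable]: "l \<in> borel_measurable ?F" unfolding l_def using lam by simp
    note V_past[of n, measurable]
    have [measurable]: "G \<in> borel_measurable ?F"
      unfolding G_def[abs_def] q_def l_def[symmetric] by measurable
    have lL: "\<bar>l \<omega>\<bar> \<le> L" "(l \<omega>)\<^sup>2 \<le> L\<^sup>2" "q (Suc n) \<omega> \<ge> 1 / 2" if "\<omega> \<in> space M" for \<omega>
      using L[of "Suc n"] lam_sq[of "Suc n"] q[of "Suc n"] that by (auto simp: l_def)
    have int: "integrable M (\<lambda>\<omega>. G \<omega> * g (l \<omega>))"
      if g[measurable]: "g \<in> borel_measurable borel" and gK: "\<And>t. \<bar>t\<bar> \<le> L \<Longrightarrow> \<bar>g t\<bar> \<le> K" for g :: "real \<Rightarrow> real" and K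
    proof (rule integrable_const_bound[where B="(B ^ n * 1 / (1 / 2)) * K"])
      show "AE \<omega> in M. norm (G \<omega> * g (l \<omega>)) \<le> (B ^ n * 1 / (1 / 2)) * K"
        using AE_B AE_space
      proof eventually_elim
        case (elim \<omega>)
        have "0 \<le> B ^ n" using L0 by (simp add: B_def)
        have "\<bar>V n \<omega>\<bar> * \<bar>indicator A \<omega>\<bar> / \<bar>q (Suc n) \<omega>\<bar> \<le> B ^ n * 1 / (1 / 2)"
          using elim lL(3)[of \<omega>] \<open>0 \<le> B ^ n\<close> by (intro frac_le mult_mono) (auto simp: indicator_def)
        then have "\<bar>G \<omega>\<bar> \<le> B ^ n * 1 / (1 / 2)"
          by (simp only: G_def abs_mult abs_divide)
        then show ?case
          using gK[OF lL(1)[OF elim(2)]] \<open>0 \<le> B ^ n\<close> unfolding real_norm_def abs_mult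
          by (intro mult_mono) auto
      qed
      show "(\<lambda>\<omega>. G \<omega> * g (l \<omega>)) \<in> borel_measurable M" by (rule past_meas) measurable
    qed
    have int0: "integrable M G" using int[of "\<lambda>_. 1" 1] by simp
    have int1: "integrable M (\<lambda>\<omega>. G \<omega> * (l \<omega> / 2))" using L0 by (intro int[of "\<lambda>t. t / 2" L]) auto
    have int2: "integrable M (\<lambda>\<omega>. G \<omega> * (c * (l \<omega>)\<^sup>2))"
      using c L0 by (intro int[of "\<lambda>t. c * t\<^sup>2" "c * L\<^sup>2"]) (auto simp: abs_mult simp flip: abs_le_square_iff)
    have b1: "\<bar>x - m\<bar> \<le> 1" and b2: "\<bar>(x - m)\<^sup>2\<bar> \<le> 1" if "x \<in> {0..1}" for x
      using that m_01 by (auto simp: abs_square_le_1 abs_le_iff)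
    have mG: "(\<lambda>\<omega>. G \<omega> * (l \<omega> / 2)) \<in> borel_measurable ?F"
      "(\<lambda>\<omega>. G \<omega> * (c * (l \<omega>)\<^sup>2)) \<in> borel_measurable ?F" by measurable
    have "integrable P (\<lambda>x. x)" by (rule integrable_P[where B=1]) auto
    then have P0: "(\<integral>x. x - m \<partial>P) = 0" using P.prob_space by (simp add: mean[symmetric])
    have e1: "expectation (\<lambda>\<omega>. G \<omega> * (l \<omega> / 2) * (X (Suc n) \<omega> - m)) = 0"
      and i1: "integrable M (\<lambda>\<omega>. G \<omega> * (l \<omega> / 2) * (X (Suc n) \<omega> - m))"
      using expectation_past_mult[where h="\<lambda>x. x - m", OF _ mG(1) int1 _ b1] by (simp_all add: P0)
    have e2: "expectation (\<lambda>\<omega>. G \<omega> * (c * (l \<omega>)\<^sup>2) * (X (Suc n) \<omega> - m)\<^sup>2)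
          = expectation (\<lambda>\<omega>. G \<omega> * (c * (l \<omega>)\<^sup>2)) * \<sigma>\<^sup>2"
      and i2: "integrable M (\<lambda>\<omega>. G \<omega> * (c * (l \<omega>)\<^sup>2) * (X (Suc n) \<omega> - m)\<^sup>2)"
      using expectation_past_mult[where h="\<lambda>x. (x - m)\<^sup>2", OF _ mG(2) int2 _ b2]
      by (simp_all flip: var)
    have expand: "g * (1 + a * x / 2 - c * (a * x)\<^sup>2) = g + g * (a / 2) * x - g * (c * a\<^sup>2) * x\<^sup>2"
      for g a x :: real
      by (simp add: power2_eq_square algebra_simps)
    have "(\<integral>\<omega>. V (Suc n) \<omega> * indicator A \<omega> \<partial>M)
        = (\<integral>\<omega>. G \<omega> + G \<omega> * (l \<omega> / 2) * (X (Suc n) \<omega> - m)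
            - G \<omega> * (c * (l \<omega>)\<^sup>2) * (X (Suc n) \<omega> - m)\<^sup>2 \<partial>M)"
    proof (rule Bochner_Integration.integral_cong)
      fix \<omega>
      have "V (Suc n) \<omega> * indicator A \<omega> = G \<omega> * Q (Suc n) \<omega>"
        by (simp add: V_def G_def)
      also have "\<dots> = G \<omega> + G \<omega> * (l \<omega> / 2) * (X (Suc n) \<omega> - m)
            - G \<omega> * (c * (l \<omega>)\<^sup>2) * (X (Suc n) \<omega> - m)\<^sup>2"
        unfolding Q_def l_def by (rule expand)
      finally show "V (Suc n) \<omega> * indicator A \<omega> = G \<omega> + G \<omega> * (l \<omega> / 2) * (X (Suc n) \<omega> - m)
            - G \<omega> * (c * (l \<omega>)\<^sup>2) * (X (Suc n) \<omega> - m)\<^sup>2" .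
    qed simp
    also have "\<dots> = expectation G - expectation (\<lambda>\<omega>. G \<omega> * (c * (l \<omega>)\<^sup>2)) * \<sigma>\<^sup>2"
      using int0 i1 i2 e1 e2 by simp
    also have "\<dots> = (\<integral>\<omega>. G \<omega> - G \<omega> * (c * (l \<omega>)\<^sup>2) * \<sigma>\<^sup>2 \<partial>M)"
      using int0 int2 by simp
    also have "\<dots> = (\<integral>\<omega>. V n \<omega> * indicator A \<omega> \<partial>M)"
    proof (rule Bochner_Integration.integral_cong)
      fix \<omega> assume "\<omega> \<in> space M"
      have "G \<omega> - G \<omega> * (c * (l \<omega>)\<^sup>2) * \<sigma>\<^sup>2 = G \<omega> * q (Suc n) \<omega>"
        by (simp add: q_def l_def algebra_simps)
      also have "\<dots> = V n \<omega> * indicator A \<omega>"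
        using lL(3)[OF \<open>\<omega> \<in> space M\<close>] by (simp add: G_def)
      finally show "G \<omega> - G \<omega> * (c * (l \<omega>)\<^sup>2) * \<sigma>\<^sup>2 = V n \<omega> * indicator A \<omega>" .
    qed simp
    finally show ?thesis .
  qed
  have AE_V: "AE \<omega> in M. \<exists>K. \<forall>n. V n \<omega> \<le> K"
  proof (rule AE_bounded_of_supermartingale[where F="\<lambda>n. past M X (Suc n)"])
    show "AE \<omega> in M. V n \<omega> \<ge> 0" for n
      using AE_nonneg AE_space
    proof eventually_elim
      case (elim \<omega>)
      then have "Q k \<omega> / q k \<omega> \<ge> 0" if "k \<ge> 1" for k
        using q[OF that elim(2)] that by (intro divide_nonneg_nonneg) auto
      then show ?case unfolding V_def by (intro prod_nonneg) auto
    qed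
  qed (use subalgebra_past past_mono V_past int_V step in auto)
  \<comment> \<open>Nothing is known about \<open>lam 0\<close>. Setting it to 0 gives measurability
    at every index and leaves the eventual lower bound intact.\<close>
  define lam' where "lam' n = (if n = 0 then (\<lambda>_. 0) else lam n)" for n
  have "Omega_p M lam' (\<lambda>n. real n powr (- 1 / 2))"
  proof (rule Omega_p_transfer[OF Omega])
    show "\<forall>\<^sub>F n in sequentially. \<forall>\<omega>\<in>space M. \<delta> * real n powr (- 1 / 2) \<le> \<bar>lam' n \<omega>\<bar>
        \<longleftrightarrow> \<delta> * real n powr (- 1 / 2) \<le> \<bar>lam n \<omega>\<bar>" for \<delta>
      using eventually_gt_at_top[of 0] by eventually_elim (simp add: lam'_def)
  qed
  moreover have "lam' n \<in> borel_measurable M" for n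
    using lam[of n] past_meas by (auto simp: lam'_def)
  ultimately have "AE \<omega> in M. \<not> summable (\<lambda>n. (lam' n \<omega>)\<^sup>2)"
    by (intro AE_not_summable_of_Omega_p)
  then show ?thesis
    using AE_V AE_Q AE_nonneg ge AE_space
  proof eventually_elim
    case (elim \<omega>)
    obtain K where K: "\<And>n. V n \<omega> \<le> K" using elim(2) by blast
    \<comment> \<open>The upper bound is 1 - u \<le> exp(-u); it converts the product of the
      \<open>q k\<close> into the exponential of a sum of squared bets.\<close>
    have qk: "q k \<omega> > 0" "q k \<omega> \<le> exp (- (c * \<sigma>\<^sup>2 * (lam k \<omega>)\<^sup>2))" if "k \<ge> 1" for k
      using q[OF that elim(6)] exp_ge_add_one_self[of "- (c * \<sigma>\<^sup>2 * (lam k \<omega>)\<^sup>2)"]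
      by (auto simp: q_def)
    define S where "S n = (\<Sum>k=1..n. (lam k \<omega>)\<^sup>2)" for n
    have "filterlim S at_top sequentially"
    proof -
      have "S = (\<lambda>n. \<Sum>k=1..n. (lam' k \<omega>)\<^sup>2)"
        unfolding S_def by (intro ext sum.cong) (auto simp: lam'_def)
      then show ?thesis
        using not_summable_sum_at_top[OF _ elim(1)] by simp
    qed
    then have "(\<lambda>n. exp (- (c * \<sigma>\<^sup>2 * S n))) \<longlonglongrightarrow> 0"
      using c \<sigma>_pos
      by (intro filterlim_compose[OF exp_at_bot] filterlim_compose[OF filterlim_uminus_at_bot_at_top]
          filterlim_tendsto_pos_mult_at_top[OF tendsto_const]) auto
    from tendsto_power[OF tendsto_mult_left[OF this, of K], of 2]
    have lim: "(\<lambda>n. (K * exp (- (c * \<sigma>\<^sup>2 * S n)))\<^sup>2) \<longlonglongrightarrow> 0" by simp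
    have W: "0 \<le> wealth m lam X n \<omega>" "wealth m lam X n \<omega> \<le> (K * exp (- (c * \<sigma>\<^sup>2 * S n)))\<^sup>2" for n
    proof -
      show "0 \<le> wealth m lam X n \<omega>"
        unfolding wealth_def
      proof (rule prod_nonneg)
        fix k assume "k \<in> {1..n}"
        then have "- 1 \<le> lam k \<omega> * (X k \<omega> - m)" using elim(5) by simp
        then show "0 \<le> 1 + lam k \<omega> * (X k \<omega> - m)" by linarith
      qed
      have "wealth m lam X n \<omega> \<le> (\<Prod>k=1..n. (Q k \<omega>)\<^sup>2)"
        unfolding wealth_def
      proof (rule prod_mono)
        fix k assume "k \<in> {1..n}"
        then have "k \<ge> 1" by simp
        then have "0 \<le> 1 + lam k \<omega> * (X k \<omega> - m)" "sqrt (1 + lam k \<omega> * (X k \<omega> - m)) \<le> Q k \<omega>"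
          using elim(3,5) by (force, blast)
        then show "0 \<le> 1 + lam k \<omega> * (X k \<omega> - m) \<and> 1 + lam k \<omega> * (X k \<omega> - m) \<le> (Q k \<omega>)\<^sup>2"
          by (blast intro: sqrt_le_D)
      qed
      also have "\<dots> = (\<Prod>k=1..n. Q k \<omega>)\<^sup>2" by (simp add: prod_power_distrib)
      also have "\<dots> \<le> (K * exp (- (c * \<sigma>\<^sup>2 * S n)))\<^sup>2"
      proof (rule power_mono)
        \<comment> \<open>Undoing the normalization: the martingale \<open>V\<close> stays below
          \<open>K\<close>, and all the decay comes from the product of the conditional
          means.\<close>
        have "(\<Prod>k=1..n. Q k \<omega>) = V n \<omega> * (\<Prod>k=1..n. q k \<omega>)"
          unfolding V_def prod.distrib[symmetric] using qk by (intro prod.cong) (auto simp: less_imp_neq[symmetric])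
        also have "\<dots> \<le> K * (\<Prod>k=1..n. exp (- (c * \<sigma>\<^sup>2 * (lam k \<omega>)\<^sup>2)))"
        proof (rule mult_mono)
          show "(\<Prod>k=1..n. q k \<omega>) \<le> (\<Prod>k=1..n. exp (- (c * \<sigma>\<^sup>2 * (lam k \<omega>)\<^sup>2)))"
            using qk by (intro prod_mono) (auto simp: less_imp_le)
          show "0 \<le> K" using K[of 0] by (simp add: V_def)
          show "0 \<le> (\<Prod>k=1..n. q k \<omega>)" using qk by (intro prod_nonneg) (auto simp: less_imp_le)
        qed (rule K)
        also have "\<dots> = K * exp (- (c * \<sigma>\<^sup>2 * S n))"
          by (simp add: S_def sum_distrib_left sum_negf flip: exp_sum)
        finally show "(\<Prod>k=1..n. Q k \<omega>) \<le> K * exp (- (c * \<sigma>\<^sup>2 * S n))" .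
        show "0 \<le> (\<Prod>k=1..n. Q k \<omega>)" using elim(4) by (intro prod_nonneg) auto
      qed
      finally show "wealth m lam X n \<omega> \<le> (K * exp (- (c * \<sigma>\<^sup>2 * S n)))\<^sup>2" .
    qed
    show ?case
      by (rule tendsto_sandwich[OF _ _ tendsto_const lim]) (use W in auto)
  qed
qed

text \<open>\<open>normal_density\<close> takes a standard deviation, so \<open>1 / \<sigma>\<close>
  encodes the variance \<open>\<sigma>\<close> to the power -2. Beyond the preceding results, the
  proof has to check that the clipping keeps the wealth factors nonnegative.\<close>

theorem proposition2p7:
  fixes M :: "'a measure" and P :: "real measure"
    and X U :: "nat \<Rightarrow> 'a \<Rightarrow> real"
    and m \<sigma> C :: real and d :: nat
  assumes "prob_space M"
    and "real_distribution P"
    and "measure P {0..1} = 1"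
    and "m = (\<integral>x. x \<partial>P)"
    and "\<sigma>\<^sup>2 = (\<integral>x. (x - m)\<^sup>2 \<partial>P)"
    and "\<sigma> > 0"
    and "prob_space.indep_vars M (\<lambda>_. borel) X {1..}"
    and "\<And>n. n \<ge> 1 \<Longrightarrow> distr M borel (X n) = P"
    and "0 < C" and "C < 1"
    and "d \<in> {0, 1}"
    and "\<And>n. n \<ge> 1 \<Longrightarrow> U n \<in> borel_measurable (past M X n)"
    and "\<And>n \<omega>. n \<ge> 1 \<Longrightarrow> \<omega> \<in> space M \<Longrightarrow> U n \<omega> \<in> {- (C / (1 - m))..C / m}"
  shows "weak_conv_m
           (\<lambda>n. distr M borel (\<lambda>\<omega>. sqrt (real n) * aGRAPA_bet d C m U X n \<omega>))
           (density lborel (normal_density 0 (1 / \<sigma>)))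
       \<and> Omega_p M (aGRAPA_bet d C m U X) (\<lambda>n. real n powr (- 1 / 2))
       \<and> (AE \<omega> in M. (\<lambda>n. wealth m (aGRAPA_bet d C m U X) X n \<omega>) \<longlonglongrightarrow> 0)"
proof -
  interpret prob_space M by fact
  interpret iid_unit_interval M X P m \<sigma>
    by unfold_locales (fact assms(7,8,3,4,5,6))+
  let ?b = "aGRAPA_bet d C m U X"
  have bounds: "- (C / (1 - m)) \<le> ?b n \<omega>" "?b n \<omega> \<le> C / m" if "n \<ge> 1" "\<omega> \<in> space M" for n \<omega>
    using bet_bounds[of C U n \<omega> d] assms(9,13) that by auto
  have Cm: "C / m > 0" "C / (1 - m) > 0" using assms(9) m_01 by auto
  have Omega: "Omega_p M ?b (\<lambda>n. real n powr (- 1 / 2))"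
    using assms(9,11,12) by (rule bet_Omega_p)
  have "AE \<omega> in M. (\<lambda>n. wealth m ?b X n \<omega>) \<longlonglongrightarrow> 0"
  proof (rule wealth_tendsto_0[OF _ _ _ Omega])
    show "?b n \<in> borel_measurable (past M X n)" if "n \<ge> 1" for n
      using that assms(12) by (intro bet_meas_past)
    show "\<bar>?b n \<omega>\<bar> \<le> C / m + C / (1 - m)" if "n \<ge> 1" "\<omega> \<in> space M" for n \<omega>
      using bounds[OF that] Cm by linarith
    show "AE \<omega> in M. \<forall>n\<ge>1. - 1 \<le> ?b n \<omega> * (X n \<omega> - m)"
      using AE_unit_all AE_space
    proof eventually_elim
      case (elim \<omega>)
      show ?case
      proof (intro allI impI)
        fix n :: nat assume n: "n \<ge> 1"
        have X: "0 \<le> X n \<omega>" "X n \<omega> \<le> 1" using elim(1) n by auto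
        note b = bounds[OF n elim(2)]
        \<comment> \<open>The worst outcome is \<open>X n = 0\<close> for a nonnegative bet and
          \<open>X n = 1\<close> for a negative one; the two clipping bounds limit the loss to
          \<open>C\<close> in either case.\<close>
        have "- C \<le> ?b n \<omega> * (X n \<omega> - m)"
        proof (cases "?b n \<omega> \<ge> 0")
          case True
          have "?b n \<omega> * (- m) \<le> ?b n \<omega> * (X n \<omega> - m)" using True X by (intro mult_left_mono) auto
          moreover have "?b n \<omega> * m \<le> C" using b m_01 by (simp add: pos_le_divide_eq)
          ultimately show ?thesis by simp
        next
          case False
          have "?b n \<omega> * (1 - m) \<le> ?b n \<omega> * (X n \<omega> - m)" using False X by (intro mult_left_mono_neg) auto
          moreover have "- C \<le> ?b n \<omega> * (1 - m)" using b(1) m_01 pos_divide_le_eq[of "1 - m" "- C"] by simp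
          ultimately show ?thesis by simp
        qed
        then show "- 1 \<le> ?b n \<omega> * (X n \<omega> - m)" using assms(10) by linarith
      qed
    qed
  qed
  with bet_weak_conv[OF assms(9,11,12)] Omega show ?thesis by blast
qed

end
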